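(* Let $B$ be a ball in $\mathbb{R}^4$, either open or closed. Then $B$ is $m$-divisible for every integer $m\ge 22$.
   Context: For a cardinal number $m$, a set $K\subset\mathbb{R}^d$ is called $m$-divisible if $K$ can be decomposed into $m$ pairwise disjoint pieces which are congruent to each other, i.e. any two pieces are mapped onto each other by an isometry of $\mathbb{R}^d$ (an element of the full isometry group of $d$-dimensional Euclidean space). *)

theory Defs
  imports "HOL-Analysis.Analysis" "HOL-Library.Equipollence" "HOL-Library.Disjoint_Sets"
begin

definition isometry_of_space :: "('a::metric_space \<Rightarrow> 'a) \<Rightarrow> bool"
  where "isometry_of_space f \<longleftrightarrow> surj f \<and> (\<forall>x y. dist (f x) (f y) = dist x y)"

definition congruent_sets :: "'a::metric_space set \<Rightarrow> 'a set \<Rightarrow> bool"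
  where "congruent_sets X Y \<longleftrightarrow> (\<exists>f. isometry_of_space f \<and> f ` X = Y)"

text \<open>
  The cardinal number of pieces is given by a representing set \<open>I\<close>; an integer \<open>m\<close>
  is represented by \<open>{..<m}\<close>. Pieces are nonempty, as required by \<^const>\<open>partition_on\<close>.
\<close>

definition divisible :: "'i set \<Rightarrow> 'a::metric_space set \<Rightarrow> bool"
  where "divisible I K \<longleftrightarrow>
    (\<exists>P. partition_on K P \<and> P \<approx> I \<and> (\<forall>X\<in>P. \<forall>Y\<in>P. congruent_sets X Y))"

end

theory Submission
  imports Defs
begin

text \<open>
  A ball is cut into \<open>m\<close> congruent pieces once there are a set \<open>S\<close> and isometries
  \<open>f\<^sub>0, \<dots>, f\<^sub>k\<close> with \<open>k = m - 1\<close> such that the sets \<open>f\<^sub>l(S)\<close> tile the ball. Take the unit ball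
  around \<open>0\<close>. For \<open>l < k\<close> let \<open>f\<^sub>l\<close> be left multiplication by a unit quaternion \<open>r\<^sub>l\<close>, and let \<open>f\<^sub>k\<close>
  be the translation by a short vector \<open>s\<close>; some map has to move the centre, since the centre lies
  in only one piece. Form the bipartite graph that joins a point \<open>a\<close>, all of whose images lie in
  the ball, to each of its images \<open>f\<^sub>l(a)\<close>. A suitable \<open>S\<close> is a set of left nodes such that every
  right node has exactly one edge that ends in \<open>S\<close>. If the graph is a forest and every right node
  except one has degree at least two, such a set is found greedily, moving away from a root: see
  \<open>exists_exact_cover\<close>.

  The graph is turned into a forest by deleting left nodes. Fix an odd prime \<open>q\<close>. A basis of the reals
  over the rationals extends the \<open>q\<close>-adic absolute value to an ultrametric norm on the reals, and
  hence to a norm \<open>\<nu>\<close> on the quaternions. The \<open>r\<^sub>i\<close> are rational quaternions with powers of \<open>q\<close>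
  in the denominator, so chosen that at each point \<open>a\<close> all but at most one of the maps
  \<open>r\<^sub>i\<close>, \<open>r\<^sub>i\<^sup>-\<^sup>1\<close> attain their largest possible factor \<open>\<nu>(r\<^sub>i a) / \<nu>(a) = g\<^sub>i > 1\<close>; moreover
  \<open>\<nu>(s) = 1\<close>. In a finite subgraph in which all degrees are at least two, no edge can expand a node
  of largest norm, so such a node has at most one rotation edge. This ping-pong argument (\<open>no_finite_core\<close>) shows that
  the subgraph contains a point \<open>a\<close> with \<open>\<nu>(a) = 1\<close>. Deleting all those points therefore removes
  every cycle. Only \<open>a = - s\<close> has to stay: it is the one node by which the centre can be
  covered, and it cannot lie on a cycle through its translation edge, because the centre has no
  other edge.

  Deletion is cheap. A point \<open>x \<noteq> 0\<close> loses the edge of the rotation \<open>r\<^sub>i\<close> only if \<open>\<nu>(r\<^sub>i\<^sup>-\<^sup>1 x) = 1\<close>.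
  Then either \<open>r\<^sub>i\<^sup>-\<^sup>1\<close> is the exceptional map at \<open>x\<close> or \<open>g\<^sub>i = 1 / \<nu>(x)\<close>, and the numbers \<open>g\<^sub>i\<close> are
  distinct, so at most two edges disappear
  (\<open>few_preimages_of_unit_size\<close>). It remains to give each \<open>x\<close> at least four rotation
  edges. The edge of \<open>r\<^sub>i\<close> is present if \<open>r\<^sub>i\<^sup>-\<^sup>1 x + s\<close> is still in the ball, for which it suffices
  that the inner product of \<open>r\<^sub>i\<close> and \<open>x\<close> is slightly negative. This holds for four indices if at
  least four of the \<open>r\<^sub>i\<close> lie near each of five unit vectors that positively span the space.

  To find the \<open>r\<^sub>i\<close>, let \<open>u\<^sub>i\<close> be purely imaginary rational unit quaternions, no two of them equal or
  opposite, and put \<open>r\<^sub>i = ((c + u\<^sub>i)\<^sup>2 / (c\<^sup>2 + 1))\<^sup>n\<close> with exponents \<open>n = n\<^sub>i\<close>. If \<open>q\<close> divides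
  \<open>c\<^sup>2 + 1\<close> but does not divide certain nonzero integers formed from the \<open>u\<^sub>i\<close>, the expansion property
  holds (\<open>powers_of_axes_expand\<close>). For large \<open>c\<close> the rotation \<open>(c + u\<^sub>i)\<^sup>2 / (c\<^sup>2 + 1)\<close> has a small angle,
  so that distinct exponents and axes \<open>u\<^sub>i\<close> close to the prescribed ones bring the \<open>r\<^sub>i\<close> close to the
  five vectors (\<open>expanding_rotations_near_targets\<close>).
\<close>

section \<open>Exact covers in forests\<close>

text \<open>
  A bipartite multigraph with edge set \<open>E\<close>, whose edges \<open>e\<close> run from \<open>p e\<close> outside \<open>X\<close> to \<open>q e\<close> inside
  \<open>X\<close>. Acyclicity is expressed by \<open>thin\<close>: no finite nonempty set of nodes spans a subgraph with all
  degrees at least two. In this form it takes no walks to state, and it can be refuted at a node that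
  is extremal for some size function.
\<close>
locale bipartite_forest =
  fixes E :: "'e set" and p q :: "'e \<Rightarrow> 'v" and X :: "'v set"
  assumes p_notin: "e \<in> E \<Longrightarrow> p e \<notin> X"
    and q_in: "e \<in> E \<Longrightarrow> q e \<in> X"
    and thin: "finite W \<Longrightarrow> W \<noteq> {} \<Longrightarrow> \<exists>v\<in>W. \<forall>e\<in>E. \<forall>e'\<in>E.
      v \<in> {p e, q e} \<longrightarrow> v \<in> {p e', q e'} \<longrightarrow> {p e, q e, p e', q e'} \<subseteq> W \<longrightarrow> e = e'"
begin

text \<open>
  Remove a node of degree at most one and induct.
\<close>
lemma fewer_edges_than_nodes:
  assumes "finite W" "W \<noteq> {}" "finite F" "F \<subseteq> E" "\<And>e. e \<in> F \<Longrightarrow> p e \<in> W \<and> q e \<in> W"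
  shows "card F < card W"
  using assms
proof (induction "card W" arbitrary: W F)
  case 0
  then show ?case by simp
next
  case (Suc n)
  obtain v where v: "v \<in> W" "\<And>e e'. \<lbrakk>e \<in> E; e' \<in> E; v \<in> {p e, q e}; v \<in> {p e', q e'};
      {p e, q e, p e', q e'} \<subseteq> W\<rbrakk> \<Longrightarrow> e = e'"
    using thin[OF Suc.prems(1,2)] by blast
  define G where "G = {e \<in> F. v \<in> {p e, q e}}"
  have "card G \<le> 1"
  proof -
    have "\<And>e e'. e \<in> G \<Longrightarrow> e' \<in> G \<Longrightarrow> e = e'"
      using v(2) Suc.prems(4,5) unfolding G_def by blast
    then show ?thesis
      using Suc.prems(3) card_le_Suc0_iff_eq[of G] unfolding G_def by auto
  qed
  show ?case
  proof (cases "W = {v}")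
    case True
    have "F = {}"
    proof (rule ccontr)
      assume "F \<noteq> {}"
      then obtain e where "e \<in> F" by blast
      then have "p e = v" "q e = v" "e \<in> E" using Suc.prems True by auto
      then show False using p_notin q_in by metis
    qed
    then show ?thesis using True by simp
  next
    case False
    have "card (F - G) < card (W - {v})"
    proof (rule Suc.hyps(1))
      show "n = card (W - {v})" using Suc v by simp
      show "finite (W - {v})" "finite (F - G)" "F - G \<subseteq> E" using Suc.prems by auto
      show "W - {v} \<noteq> {}" using False v by auto
      show "p e \<in> W - {v} \<and> q e \<in> W - {v}" if "e \<in> F - G" for e
        using that Suc.prems(5) unfolding G_def by auto
    qed
    moreover have "card F \<le> card (F - G) + card G"
      using card_Un_le[of "F - G" G] unfolding G_def by (simp add: Un_Diff_cancel2 Un_absorb2 subset_iff)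
    moreover have "card (W - {v}) = card W - 1" "card W > 0"
      using v Suc.prems by (auto simp: card_gt_0_iff)
    ultimately show ?thesis using \<open>card G \<le> 1\<close> by linarith
  qed
qed

definition adj :: "('v \<times> 'v) set"
  where "adj = {(u, v). \<exists>e\<in>E. (u = p e \<and> v = q e) \<or> (u = q e \<and> v = p e)}"

lemma adj_sym: "(u, v) \<in> adj \<Longrightarrow> (v, u) \<in> adj"
  unfolding adj_def by blast

lemma adj_edge: "e \<in> E \<Longrightarrow> (p e, q e) \<in> adj"
  unfolding adj_def by blast

lemma adj_parity: "(u, v) \<in> adj ^^ n \<Longrightarrow> (v \<in> X \<longleftrightarrow> (if even n then u \<in> X else u \<notin> X))"
proof (induction n arbitrary: v)
  case (Suc n)
  then obtain w where "(u, w) \<in> adj ^^ n" "(w, v) \<in> adj" by auto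
  with Suc.IH[of w] show ?case
    unfolding adj_def using p_notin q_in by auto
qed auto

text \<open>
  Choose a root in \<open>X\<close> for each component, with \<open>x0\<close> as the root of its own, and measure depth by the
  distance to the root. By counting edges, every other node has a single edge towards the root. Hence
  each \<open>x\<close> in \<open>X\<close> has an edge that leads away from the root, and the cover can be built level by
  level: if \<open>x\<close> is not yet covered from above, cover it by one edge leading away from the root.
\<close>
lemma exists_exact_cover:
  assumes deg: "\<And>x. x \<in> X \<Longrightarrow> x \<noteq> x0 \<Longrightarrow> \<exists>e\<in>E. \<exists>e'\<in>E. e \<noteq> e' \<and> q e = x \<and> q e' = x"
    and deg0: "x0 \<in> X" "\<exists>e\<in>E. q e = x0"
  shows "\<exists>S \<subseteq> p ` E. \<forall>x\<in>X. \<exists>!e. e \<in> E \<and> q e = x \<and> p e \<in> S"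
proof -
  define root where "root v = (if (v, x0) \<in> adj\<^sup>* then x0 else SOME u. u \<in> X \<and> (v, u) \<in> adj\<^sup>*)" for v
  have root_adj: "root u = root v" if "(u, v) \<in> adj" for u v
  proof -
    have "(u, w) \<in> adj\<^sup>* \<longleftrightarrow> (v, w) \<in> adj\<^sup>*" for w
      using that adj_sym by (meson converse_rtrancl_into_rtrancl)
    then show ?thesis unfolding root_def by simp
  qed
  define V where "V = X \<union> p ` E"
  have root_X: "root v \<in> X" "(v, root v) \<in> adj\<^sup>*" if v: "v \<in> V" for v
  proof -
    have ex: "\<exists>u. u \<in> X \<and> (v, u) \<in> adj\<^sup>*"
    proof (cases "v \<in> X")
      case False
      then obtain e where "e \<in> E" "v = p e" using v unfolding V_def by blast
      then show ?thesis using adj_edge q_in by blast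
    qed auto
    from someI_ex[OF ex] show "root v \<in> X" "(v, root v) \<in> adj\<^sup>*"
      unfolding root_def using deg0 by auto
  qed
  define d where "d v = (LEAST n. (v, root v) \<in> adj ^^ n)" for v
  have d_path: "(v, root v) \<in> adj ^^ (d v)" if "v \<in> V" for v
    unfolding d_def using root_X(2)[OF that] by (metis LeastI rtrancl_power)
  have d_le: "d v \<le> n" if "(v, root v) \<in> adj ^^ n" for v n
    unfolding d_def using that by (rule Least_le)
  have adj_V: "u \<in> V" "v \<in> V" if "(u, v) \<in> adj" for u v
    using that q_in unfolding adj_def V_def by auto
  have d_adj_le: "d u \<le> Suc (d v)" if "(u, v) \<in> adj" for u v
  proof (rule d_le)
    show "(u, root u) \<in> adj ^^ Suc (d v)"
      using relpow_Suc_I2[OF that d_path[OF adj_V(2)[OF that]]] unfolding root_adj[OF that] .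
  qed
  have d_parity: "v \<in> X \<longleftrightarrow> even (d v)" if "v \<in> V" for v
    using adj_parity[OF d_path[OF that]] root_X(1)[OF that] by (auto split: if_splits)
  have d_edge: "d (p e) = Suc (d (q e)) \<or> d (q e) = Suc (d (p e))" if "e \<in> E" for e
  proof -
    have "(p e, q e) \<in> adj" by (rule adj_edge[OF that])
    then have "d (p e) \<le> Suc (d (q e))" "d (q e) \<le> Suc (d (p e))"
      using d_adj_le adj_sym by blast+
    moreover have "even (d (q e))" "odd (d (p e))"
      using d_parity p_notin[OF that] q_in[OF that] adj_V[OF adj_edge[OF that]] by blast+
    ultimately show ?thesis by presburger
  qed
  define lower where "lower v e = (e \<in> E \<and> ((v = p e \<and> d (q e) < d v) \<or> (v = q e \<and> d (p e) < d v)))" for v e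
  define other where "other v e = (if v = p e then q e else p e)" for v e
  have pq: "p e \<noteq> q e" if "e \<in> E" for e using p_notin[OF that] q_in[OF that] by metis
  have other: "d (other v e) < d v \<and> {v, other v e} = {p e, q e} \<and> other v e \<in> V \<and> root (other v e) = root v
      \<and> d v = Suc (d (other v e))"
    if "lower v e" for v e
  proof -
    have e: "e \<in> E" using that lower_def by blast
    have "other v e \<in> V" using e adj_V[OF adj_edge[OF e]] unfolding other_def by auto
    moreover have "root (p e) = root (q e)" using root_adj[OF adj_edge[OF e]] .
    ultimately show ?thesis
      using that d_edge[OF e] pq[OF e] unfolding lower_def other_def by auto
  qed
  have lower_ex: "\<exists>e. lower v e" if "v \<in> V" "d v \<noteq> 0" for v
  proof -
    obtain n where n: "d v = Suc n" using \<open>d v \<noteq> 0\<close> not0_implies_Suc by blast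
    then have "(v, root v) \<in> adj ^^ Suc n" using d_path[OF that(1)] by simp
    then obtain u where u: "(v, u) \<in> adj" "(u, root v) \<in> adj ^^ n"
      by (blast dest: relpow_Suc_D2)
    then have "d u \<le> n" using d_le root_adj[OF u(1)] by metis
    then show ?thesis using u(1) n unfolding adj_def lower_def by fastforce
  qed
  define up where "up v = (SOME e. lower v e)" for v
  have up: "lower v (up v)" if "v \<in> V" "d v \<noteq> 0" for v
    unfolding up_def using lower_ex[OF that] by (rule someI_ex)
  \<comment> \<open>the path from \<open>v\<close> to its root, as a set closed under going up\<close>
  have ancestors: "\<exists>W. finite W \<and> v \<in> W \<and> root v \<in> W \<and> W \<subseteq> V \<and> (\<forall>u\<in>W. d u \<le> d v \<and> root u = root v) \<and>
      (\<forall>u\<in>W. d u \<noteq> 0 \<longrightarrow> other u (up u) \<in> W)" if "v \<in> V" for v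
    using that
  proof (induction "d v" arbitrary: v)
    case 0
    then have "root v = v" using d_path[of v] by auto
    then show ?case using 0 by (intro exI[of _ "{v}"]) auto
  next
    case (Suc n)
    let ?u = "other v (up v)"
    have l: "lower v (up v)" using up Suc by simp
    obtain W where "finite W \<and> ?u \<in> W \<and> root ?u \<in> W \<and> W \<subseteq> V \<and> (\<forall>u\<in>W. d u \<le> d ?u \<and> root u = root ?u) \<and>
      (\<forall>u\<in>W. d u \<noteq> 0 \<longrightarrow> other u (up u) \<in> W)"
      using Suc.hyps(1)[of ?u] Suc.hyps(2) other[OF l] by auto
    then show ?case
      using other[OF l] Suc.prems by (intro exI[of _ "insert v W"]) auto
  qed
  have lower_unique: "e = e'" if "v \<in> V" "lower v e" "lower v e'" for v e e'
  proof (rule ccontr)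
    assume ne: "e \<noteq> e'"
    let ?o = "other v e" and ?o' = "other v e'"
    note o = other[OF that(2)] and o' = other[OF that(3)]
    obtain U where U: "finite U" "?o \<in> U" "root ?o \<in> U" "U \<subseteq> V" "\<forall>u\<in>U. d u \<le> d ?o \<and> root u = root ?o"
      "\<forall>u\<in>U. d u \<noteq> 0 \<longrightarrow> other u (up u) \<in> U" using ancestors[of ?o] o by blast
    obtain U' where U': "finite U'" "?o' \<in> U'" "root ?o' \<in> U'" "U' \<subseteq> V" "\<forall>u\<in>U'. d u \<le> d ?o' \<and> root u = root ?o'"
      "\<forall>u\<in>U'. d u \<noteq> 0 \<longrightarrow> other u (up u) \<in> U'" using ancestors[of ?o'] o' by blast
    define W where "W = U \<union> U'"
    define N where "N = W - {root v}"
    have W: "finite W" "root v \<in> W" "W \<subseteq> V" "?o \<in> W" "?o' \<in> W" "\<forall>u\<in>W. d u < d v \<and> root u = root v"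
      "\<forall>u\<in>W. d u \<noteq> 0 \<longrightarrow> other u (up u) \<in> W"
      using U U' o o' unfolding W_def by (auto simp: le_less_trans)
    have d0: "u = root v" if "u \<in> W" "d u = 0" for u
      using that W d_path[of u] by auto
    have upN: "lower u (up u)" if "u \<in> N" for u
      using that d0 up W(3) unfolding N_def by blast
    have vW: "v \<notin> W" using W(6) by blast
    have high: "u = u'" if "lower u x" "lower u' x" for u u' x
      using that unfolding lower_def by auto
    have inj: "inj_on up N" by (rule inj_onI) (metis high upN)
    have disj: "up ` N \<inter> {e, e'} = {}"
      using high upN that vW N_def by blast
    \<comment> \<open>The edges \<open>e\<close>, \<open>e'\<close> together with one upward edge per non-root ancestor are as many as the nodes.\<close>
    have "card (up ` N \<union> {e, e'}) = card N + 2"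
      using disj inj ne W(1) by (subst card_Un_disjoint) (auto simp: card_image N_def)
    moreover have "card (insert v W) = card N + 2"
      using card_Suc_Diff1[OF W(1,2)] W(1) vW unfolding N_def by simp
    moreover have "card (up ` N \<union> {e, e'}) < card (insert v W)"
    proof (rule fewer_edges_than_nodes)
      show "up ` N \<union> {e, e'} \<subseteq> E" using upN that lower_def by auto
      fix x assume "x \<in> up ` N \<union> {e, e'}"
      then consider u where "u \<in> N" "x = up u" | "x = e" | "x = e'" by auto
      then show "p x \<in> insert v W \<and> q x \<in> insert v W"
      proof cases
        case 1
        then have "u \<in> W" "d u \<noteq> 0" using upN[of u] unfolding N_def lower_def by auto
        then have "{u, other u (up u)} \<subseteq> W" using W by blast
        then show ?thesis using other[OF upN[OF 1(1)]] 1 by auto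
      next
        case 2
        have "{v, ?o} \<subseteq> insert v W" using W by blast
        then show ?thesis using o 2 by auto
      next
        case 3
        have "{v, ?o'} \<subseteq> insert v W" using W by blast
        then show ?thesis using o' 3 by auto
      qed
    qed (use W(1) N_def in auto)
    ultimately show False by simp
  qed
  have root0: "d x0 = 0"
  proof -
    have "root x0 = x0" unfolding root_def by simp
    then have "(x0, root x0) \<in> adj ^^ 0" by simp
    then show ?thesis using d_le by blast
  qed
  define child where "child x = (SOME e. e \<in> E \<and> q e = x \<and> d x < d (p e))" for x
  have child: "child x \<in> E \<and> q (child x) = x \<and> d x < d (p (child x))" if x: "x \<in> X" for x
  proof -
    have "\<exists>e. e \<in> E \<and> q e = x \<and> d x < d (p e)"
    proof (cases "d x = 0")
      case True
      obtain e where e: "e \<in> E" "q e = x" using deg[of x] deg0 x by metis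
      then show ?thesis using d_edge[OF e(1)] True by auto
    next
      case False
      then have "x \<noteq> x0" using root0 by auto
      then obtain e e' where e: "e \<in> E" "e' \<in> E" "e \<noteq> e'" "q e = x" "q e' = x"
        using deg[OF x] by blast
      have "x \<in> V" using that V_def by simp
      then have "\<not> (lower x e \<and> lower x e')" using lower_unique e(3) by blast
      then show ?thesis using e d_edge[OF e(1)] d_edge[OF e(2)] unfolding lower_def by auto
    qed
    then show ?thesis unfolding child_def by (rule someI_ex)
  qed
  \<comment> \<open>the nodes selected to cover the elements of \<open>X\<close> of depth below \<open>n\<close>\<close>
  define T where "T = rec_nat {} (\<lambda>n T. T \<union> {p (child x) | x. x \<in> X \<and> d x = n \<and> \<not> (\<exists>e\<in>E. q e = x \<and> p e \<in> T)})"
  have T0: "T 0 = {}" and TS: "T (Suc n) = T n \<union> {p (child x) | x. x \<in> X \<and> d x = n \<and> \<not> (\<exists>e\<in>E. q e = x \<and> p e \<in> T n)}" for n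
    unfolding T_def by auto
  have T_mono: "T n \<subseteq> T k" if "n \<le> k" for n k
    using that by (rule lift_Suc_mono_le[rotated]) (auto simp: TS)
  have T_elem: "\<exists>x\<in>X. d x < n \<and> v = p (child x) \<and> \<not> (\<exists>e\<in>E. q e = x \<and> p e \<in> T (d x))" if "v \<in> T n" for v n
    using that
  proof (induction n)
    case (Suc n)
    then show ?case unfolding TS by (auto simp: less_Suc_eq)
  qed (simp add: T0)
  define S where "S = (\<Union>n. T n)"
  have S_elem: "\<exists>x\<in>X. v = p (child x) \<and> \<not> (\<exists>e\<in>E. q e = x \<and> p e \<in> T (d x))" if "v \<in> S" for v
    using that T_elem unfolding S_def by blast
  have S_down: "e = child (q e) \<and> \<not> (\<exists>e'\<in>E. q e' = q e \<and> p e' \<in> T (d (q e)))"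
    if e: "e \<in> E" "p e \<in> S" "d (q e) < d (p e)" for e
  proof -
    obtain x where x: "x \<in> X" "p e = p (child x)" "\<not> (\<exists>e\<in>E. q e = x \<and> p e \<in> T (d x))"
      using S_elem[OF e(2)] by blast
    have "lower (p e) e" using that unfolding lower_def by blast
    moreover have "lower (p e) (child x)" using child[OF x(1)] x(2) unfolding lower_def by auto
    ultimately have "e = child x" using lower_unique[of "p e"] that(1) V_def by blast
    then show ?thesis using child[OF x(1)] x by metis
  qed
  have S_up: "p e \<in> T (d (q e))" if "e \<in> E" "p e \<in> S" "\<not> d (q e) < d (p e)" for e
  proof -
    from that(2) obtain n where "p e \<in> T n" unfolding S_def by blast
    then obtain x where x: "x \<in> X" "p e = p (child x)" "\<not> (\<exists>e\<in>E. q e = x \<and> p e \<in> T (d x))"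
      using T_elem by blast
    have "p (child x) \<in> T (Suc (d x))" unfolding TS using x by blast
    moreover have "Suc (d x) \<le> d (q e)" using child[OF x(1)] that d_edge[OF that(1)] unfolding x(2) by linarith
    ultimately show ?thesis using T_mono x(2) by fastforce
  qed
  have "\<exists>!e. e \<in> E \<and> q e = x \<and> p e \<in> S" if x: "x \<in> X" for x
  proof (cases "\<exists>e\<in>E. q e = x \<and> p e \<in> T (d x)")
    case True
    then obtain e where e: "e \<in> E" "q e = x" "p e \<in> T (d x)" by blast
    show ?thesis
    proof (rule ex1I[of _ e])
      show "e \<in> E \<and> q e = x \<and> p e \<in> S" using e S_def by blast
      fix e' assume e': "e' \<in> E \<and> q e' = x \<and> p e' \<in> S"
      have low: "lower x g" if "g \<in> E" "q g = x" "p g \<in> S" for g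
      proof -
        have "\<not> d (q g) < d (p g)" using S_down[OF that(1,3)] True that(2) by auto
        then show ?thesis using d_edge[OF that(1)] that unfolding lower_def by auto
      qed
      show "e' = e" using lower_unique[of x e' e] low e e' x V_def S_def by blast
    qed
  next
    case False
    show ?thesis
    proof (rule ex1I[of _ "child x"])
      have "p (child x) \<in> T (Suc (d x))" unfolding TS using x False by blast
      then show "child x \<in> E \<and> q (child x) = x \<and> p (child x) \<in> S" using child[OF x] S_def by blast
      fix e assume e: "e \<in> E \<and> q e = x \<and> p e \<in> S"
      then show "e = child x" using S_up S_down False by metis
    qed
  qed
  moreover have "S \<subseteq> p ` E" using S_elem child by blast
  ultimately show ?thesis by blast
qed

end

section \<open>Partitions from exact covers\<close>

lemma isometry_of_space_comp:
  "isometry_of_space f \<Longrightarrow> isometry_of_space g \<Longrightarrow> isometry_of_space (g \<circ> f)"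
  unfolding isometry_of_space_def using comp_surj[of f g] by simp

lemma isometry_of_space_inj: "isometry_of_space f \<Longrightarrow> inj f"
  unfolding isometry_of_space_def by (metis dist_eq_0_iff injI)

lemma isometry_of_space_inv:
  assumes "isometry_of_space f"
  shows "isometry_of_space (inv f)"
proof -
  have f: "surj f" "\<And>x y. dist (f x) (f y) = dist x y"
    using assms unfolding isometry_of_space_def by auto
  have "dist (inv f x) (inv f y) = dist x y" for x y
    using f(2)[of "inv f x" "inv f y"] by (simp add: surj_f_inv_f[OF f(1)])
  then show ?thesis
    using inj_imp_surj_inv[OF isometry_of_space_inj[OF assms]] unfolding isometry_of_space_def by blast
qed

lemma congruent_sets_images:
  assumes "isometry_of_space f" "isometry_of_space g"
  shows "congruent_sets (f ` S) (g ` S)"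
  unfolding congruent_sets_def
proof (intro exI conjI)
  show "isometry_of_space (g \<circ> inv f)"
    using assms by (intro isometry_of_space_comp isometry_of_space_inv)
  show "(g \<circ> inv f) ` f ` S = g ` S"
    using isometry_of_space_inj[OF assms(1)] by (simp add: image_comp comp_assoc)
qed

text \<open>
  Uniqueness of the pair \<open>(l, a)\<close> makes the images of \<open>S\<close> disjoint and, as \<open>S\<close> is nonempty, distinct for
  distinct labels.
\<close>
lemma divisible_by_exact_cover:
  fixes f :: "'i \<Rightarrow> 'a::metric_space \<Rightarrow> 'a"
  assumes iso: "\<And>l. l \<in> L \<Longrightarrow> isometry_of_space (f l)"
    and sub: "\<And>l a. l \<in> L \<Longrightarrow> a \<in> S \<Longrightarrow> f l a \<in> K"
    and cover: "\<And>x. x \<in> K \<Longrightarrow> \<exists>!(l, a). l \<in> L \<and> a \<in> S \<and> f l a = x"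
    and "K \<noteq> {}"
  shows "divisible L K"
proof -
  let ?P = "(\<lambda>l. f l ` S) ` L"
  have covered: "\<exists>l\<in>L. \<exists>a\<in>S. f l a = x" if "x \<in> K" for x
    using ex1_implies_ex[OF cover[OF that]] by auto
  then have S: "S \<noteq> {}" using \<open>K \<noteq> {}\<close> by blast
  have uniq: "l = l'" if "l \<in> L" "l' \<in> L" "a \<in> S" "a' \<in> S" "f l a = f l' a'" for l l' a a'
  proof -
    note unique = cover[OF sub[OF that(1,3)]]
    obtain z where "\<And>y. (case y of (m, b) \<Rightarrow> m \<in> L \<and> b \<in> S \<and> f m b = f l a) \<Longrightarrow> y = z"
      using unique by (elim ex1E) blast
    from this[of "(l, a)"] this[of "(l', a')"] show ?thesis using that by auto
  qed
  have disj: "l = l'" if "l \<in> L" "l' \<in> L" "f l ` S \<inter> f l' ` S \<noteq> {}" for l l'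
  proof -
    have "\<exists>a\<in>S. \<exists>a'\<in>S. f l a = f l' a'" using that(3) by auto
    then show ?thesis using uniq[OF that(1,2)] by auto
  qed
  have "partition_on K ?P"
  proof (rule partition_onI)
    show "\<Union>?P = K"
    proof
      show "K \<subseteq> \<Union>?P" using covered by fast
    qed (use sub in auto)
    show "disjnt A B" if "A \<in> ?P" "B \<in> ?P" "A \<noteq> B" for A B
      using that disj unfolding disjnt_def by blast
    show "{} \<notin> ?P" using S by auto
  qed
  moreover have "?P \<approx> L"
  proof -
    have "inj_on (\<lambda>l. f l ` S) L"
    proof (rule inj_onI)
      fix l l' assume "l \<in> L" "l' \<in> L" "f l ` S = f l' ` S"
      then show "l = l'" using disj[of l l'] S by auto
    qed
    then show ?thesis by (simp add: inj_on_image_eqpoll_self)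
  qed
  moreover have "\<forall>X\<in>?P. \<forall>Y\<in>?P. congruent_sets X Y"
    using iso congruent_sets_images by blast
  ultimately show ?thesis unfolding divisible_def by blast
qed

section \<open>Quaternions\<close>

text \<open>
  Hamilton's product, the first coordinate being the real part.
\<close>
definition qmul :: "real^4 \<Rightarrow> real^4 \<Rightarrow> real^4" (infixl "\<odot>" 70)
  where "x \<odot> y = vector
    [x$1 * y$1 - x$2 * y$2 - x$3 * y$3 - x$4 * y$4,
     x$1 * y$2 + x$2 * y$1 + x$3 * y$4 - x$4 * y$3,
     x$1 * y$3 - x$2 * y$4 + x$3 * y$1 + x$4 * y$2,
     x$1 * y$4 + x$2 * y$3 - x$3 * y$2 + x$4 * y$1]"

definition qcnj :: "real^4 \<Rightarrow> real^4"
  where "qcnj x = vector [x$1, - x$2, - x$3, - x$4]"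

lemma vector_4 [simp]:
  "(vector [a, b, c, d] :: 'a::zero^4) $ 1 = a" "(vector [a, b, c, d] :: 'a^4) $ 2 = b"
  "(vector [a, b, c, d] :: 'a^4) $ 3 = c" "(vector [a, b, c, d] :: 'a^4) $ 4 = d"
  unfolding vector_def by simp_all

lemma inner_4: "(x::real^4) \<bullet> y = x$1 * y$1 + x$2 * y$2 + x$3 * y$3 + x$4 * y$4"
  by (simp add: inner_vec_def sum_4)

lemma qmul_nth:
  "(x \<odot> y)$1 = x$1 * y$1 - x$2 * y$2 - x$3 * y$3 - x$4 * y$4"
  "(x \<odot> y)$2 = x$1 * y$2 + x$2 * y$1 + x$3 * y$4 - x$4 * y$3"
  "(x \<odot> y)$3 = x$1 * y$3 - x$2 * y$4 + x$3 * y$1 + x$4 * y$2"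
  "(x \<odot> y)$4 = x$1 * y$4 + x$2 * y$3 - x$3 * y$2 + x$4 * y$1"
  by (simp_all add: qmul_def)

lemma qcnj_nth: "qcnj x $ 1 = x$1" "qcnj x $ 2 = - x$2" "qcnj x $ 3 = - x$3" "qcnj x $ 4 = - x$4"
  by (simp_all add: qcnj_def)

lemma vec4_eq_iff: "(x::'a^4) = y \<longleftrightarrow> x$1 = y$1 \<and> x$2 = y$2 \<and> x$3 = y$3 \<and> x$4 = y$4"
  by (simp add: vec_eq_iff forall_4)

lemma qmul_add_right: "x \<odot> (y + z) = x \<odot> y + x \<odot> z"
  by (simp add: vec4_eq_iff qmul_nth algebra_simps)

lemma qmul_add_left: "(x + y) \<odot> z = x \<odot> z + y \<odot> z"
  by (simp add: vec4_eq_iff qmul_nth algebra_simps)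

lemma qmul_diff_right: "x \<odot> (y - z) = x \<odot> y - x \<odot> z"
  by (simp add: vec4_eq_iff qmul_nth algebra_simps)

lemma qmul_scaleR_left: "(t *\<^sub>R x) \<odot> y = t *\<^sub>R (x \<odot> y)"
  by (simp add: vec4_eq_iff qmul_nth algebra_simps)

lemma qmul_real: "x \<odot> axis 1 t = t *\<^sub>R x"
  by (simp add: vec4_eq_iff qmul_nth axis_def)

lemma qcnj_scaleR: "qcnj (t *\<^sub>R x) = t *\<^sub>R qcnj x"
  by (simp add: vec4_eq_iff qcnj_nth)

lemma inner_qcnj: "qcnj x \<bullet> qcnj y = x \<bullet> y"
  by (simp add: inner_4 qcnj_nth)

lemma qmul_cancel: "qcnj x \<odot> (x \<odot> y) = (x \<bullet> x) *\<^sub>R y" "x \<odot> (qcnj x \<odot> y) = (x \<bullet> x) *\<^sub>R y"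
  by (simp_all add: vec4_eq_iff qmul_nth qcnj_nth inner_4 algebra_simps)

lemma norm_qmul: "norm (x \<odot> y) = norm x * norm y"
proof -
  have "(x \<odot> y) \<bullet> (x \<odot> y) = (x \<bullet> x) * (y \<bullet> y)"
    by (simp add: inner_4 qmul_nth algebra_simps)
  then show ?thesis by (simp add: norm_eq_sqrt_inner real_sqrt_mult)
qed

lemma norm_qcnj: "norm (qcnj x) = norm x"
  by (simp add: norm_eq_sqrt_inner inner_qcnj)

text \<open>
  This identity decides whether the preimage of \<open>y\<close> under the rotation \<open>x\<close> can be translated in
  the real direction without leaving the ball.
\<close>
lemma qmul_real_part: "(qcnj x \<odot> y) $ 1 = x \<bullet> y"
  by (simp add: inner_4 qmul_nth qcnj_nth)

section \<open>Expanding rotations and the unit ball\<close>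

text \<open>
  What the \<open>q\<close>-adic norm has to provide. Among the left multiplications by \<open>r i\<close> and by its
  inverse \<open>qcnj (r i)\<close>, at most one fails to multiply the size \<open>nu a\<close> by its gain. The gains differ
  from each other so that the size of a point determines at most one index at which a preimage
  of size \<open>1\<close> can arise by full expansion.
\<close>
locale expanding_rotations =
  fixes k :: nat and r :: "nat \<Rightarrow> real^4" and s :: "real^4" and nu :: "real^4 \<Rightarrow> real" and g :: "nat \<Rightarrow> real"
  assumes norm_r: "i < k \<Longrightarrow> norm (r i) = 1"
    and nu_pos: "a \<noteq> 0 \<Longrightarrow> nu a > 0"
    and nu_add: "nu (a + b) \<le> max (nu a) (nu b)"
    and nu_uminus: "nu (- a) = nu a"
    and gain_gt_1: "i < k \<Longrightarrow> g i > 1"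
    and gain_inj: "i < k \<Longrightarrow> j < k \<Longrightarrow> g i = g j \<Longrightarrow> i = j"
    and expand_forward: "i < k \<Longrightarrow> j < k \<Longrightarrow> i \<noteq> j \<Longrightarrow>
      nu (r i \<odot> a) = g i * nu a \<or> nu (r j \<odot> a) = g j * nu a"
    and expand_backward: "i < k \<Longrightarrow> j < k \<Longrightarrow> i \<noteq> j \<Longrightarrow>
      nu (qcnj (r i) \<odot> a) = g i * nu a \<or> nu (qcnj (r j) \<odot> a) = g j * nu a"
    and expand_mixed: "i < k \<Longrightarrow> j < k \<Longrightarrow>
      nu (r i \<odot> a) = g i * nu a \<or> nu (qcnj (r j) \<odot> a) = g j * nu a"
    and backward_le: "i < k \<Longrightarrow> nu (qcnj (r i) \<odot> a) \<le> g i * nu a"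
    and nu_s: "nu s = 1"
    and expand_s: "i < k \<Longrightarrow> nu (qcnj (r i) \<odot> s) = g i"

context expanding_rotations
begin

lemma r_cancel: "i < k \<Longrightarrow> qcnj (r i) \<odot> (r i \<odot> a) = a" "i < k \<Longrightarrow> r i \<odot> (qcnj (r i) \<odot> a) = a"
  using norm_r[of i] by (simp_all add: qmul_cancel norm_eq_1)

lemma nu_diff: "nu (a - b) \<le> max (nu a) (nu b)"
  using nu_add[of a "- b"] by (simp add: nu_uminus)

text \<open>
  \<open>FA\<close> and \<open>FX\<close> are the two sides of a finite subgraph with all degrees at least two. A node of
  largest size cannot have two rotation edges, since one of them would expand it; so it has a
  translation edge, from \<open>a\<close> to \<open>a + s\<close>. If the largest size exceeds \<open>1\<close>, both ends of this edge have it,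
  and the two rotation edges that continue from them are both non-expanding, against the mixed
  expansion property. Otherwise \<open>nu a < 1\<close>, so \<open>a + s\<close> looks like \<open>s\<close> to every rotation and is expanded
  beyond the largest size.
\<close>
lemma no_finite_core:
  assumes fin: "finite FA" "finite FX" "FA \<union> FX \<noteq> {}"
    and FA: "\<And>a. a \<in> FA \<Longrightarrow> (\<exists>i<k. \<exists>j<k. i \<noteq> j \<and> r i \<odot> a \<in> FX \<and> r j \<odot> a \<in> FX) \<or>
      (\<exists>i<k. r i \<odot> a \<in> FX \<and> a + s \<in> FX)"
    and FX: "\<And>x. x \<in> FX \<Longrightarrow>
      (\<exists>i<k. \<exists>j<k. i \<noteq> j \<and> qcnj (r i) \<odot> x \<in> FA \<and> qcnj (r j) \<odot> x \<in> FA) \<or>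
      (\<exists>i<k. qcnj (r i) \<odot> x \<in> FA \<and> x - s \<in> FA)"
    and allowed: "\<And>a. a \<in> FA \<Longrightarrow> a \<noteq> 0 \<and> (nu a = 1 \<longrightarrow> a = - s)"
  shows False
proof -
  have zero: "0 \<notin> FX"
  proof
    assume "0 \<in> FX"
    moreover have "y \<odot> 0 = 0" for y by (simp add: vec4_eq_iff qmul_nth)
    ultimately have "0 \<in> FA" using FX[of 0] by auto
    then show False using allowed by blast
  qed
  define M where "M = Max (nu ` (FA \<union> FX))"
  have M: "nu v \<le> M" if "v \<in> FA \<union> FX" for v
    unfolding M_def using fin that by (intro Max_ge) auto
  have "M \<in> nu ` (FA \<union> FX)" unfolding M_def using fin by (intro Max_in) auto
  then obtain v where v: "v \<in> FA \<union> FX" "nu v = M" by auto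
  have "v \<noteq> 0" using v zero allowed by blast
  then have "M > 0" using v nu_pos by blast
  have grow: "g i * M > M" if "i < k" for i
    using gain_gt_1[OF that] \<open>M > 0\<close> by simp
  have A_max: "\<exists>i<k. nu (r i \<odot> a) \<noteq> g i * nu a \<and> a + s \<in> FX" if "a \<in> FA" "nu a = M" for a
  proof -
    have no: "nu (r i \<odot> a) \<noteq> g i * nu a" if "i < k" "r i \<odot> a \<in> FX" for i
      using M[of "r i \<odot> a"] grow[OF that(1)] that \<open>nu a = M\<close> by auto
    then show ?thesis using FA[OF \<open>a \<in> FA\<close>] expand_forward by blast
  qed
  have X_max: "\<exists>i<k. qcnj (r i) \<odot> x \<in> FA \<and> x - s \<in> FA" if "x \<in> FX" "nu x = M" for x
  proof -
    have no: "nu (qcnj (r i) \<odot> x) \<noteq> g i * nu x" if "i < k" "qcnj (r i) \<odot> x \<in> FA" for i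
      using M[of "qcnj (r i) \<odot> x"] grow[OF that(1)] that \<open>nu x = M\<close> by auto
    then show ?thesis using FX[OF \<open>x \<in> FX\<close>] expand_backward by blast
  qed
  obtain a where a: "a \<in> FA" "a + s \<in> FX" "M > 1 \<Longrightarrow> nu a = M"
  proof (cases "v \<in> FA")
    case True
    then show ?thesis using A_max v that by blast
  next
    case False
    then have "v - s \<in> FA" using X_max v by blast
    moreover have "nu (v - s) = M" if "M > 1"
      using M[of "v - s"] \<open>v - s \<in> FA\<close> nu_add[of "v - s" s] nu_s that v(2) by auto
    ultimately show ?thesis using that[of "v - s"] False v by auto
  qed
  show False
  proof (cases "M > 1")
    case True
    obtain i where i: "i < k" "nu (r i \<odot> a) \<noteq> g i * nu a" using A_max a True by blast
    have "nu (a + s) = M"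
      using M[of "a + s"] a nu_diff[of "a + s" s] nu_s True by auto
    then obtain j where j: "j < k" "qcnj (r j) \<odot> (a + s) \<in> FA" using X_max a by blast
    have "nu (qcnj (r j) \<odot> a) \<le> max (nu (qcnj (r j) \<odot> (a + s))) (nu (qcnj (r j) \<odot> s))"
      using nu_diff[of "qcnj (r j) \<odot> (a + s)" "qcnj (r j) \<odot> s"] by (simp add: qmul_add_right)
    also have "\<dots> \<le> max M (g j)"
      using M[of "qcnj (r j) \<odot> (a + s)"] j expand_s[OF j(1)] by auto
    also have "\<dots> < g j * M"
      using grow[OF j(1)] True gain_gt_1[OF j(1)] by auto
    finally show False using expand_mixed[OF i(1) j(1), of a] i(2) a(3) True by auto
  next
    case False
    have "nu a \<noteq> 1" using allowed[OF a(1)] a(2) zero by auto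
    then have "nu a < 1" using M[of a] a(1) False by auto
    obtain j where j: "j < k" "qcnj (r j) \<odot> (a + s) \<in> FA" using FX[OF a(2)] by blast
    have "g j \<le> max (nu (qcnj (r j) \<odot> (a + s))) (nu (qcnj (r j) \<odot> a))"
      using nu_diff[of "qcnj (r j) \<odot> (a + s)" "qcnj (r j) \<odot> a"] expand_s[OF j(1)]
      by (simp add: qmul_add_right)
    moreover have "nu (qcnj (r j) \<odot> (a + s)) < g j"
      using M[of "qcnj (r j) \<odot> (a + s)"] j False gain_gt_1[OF j(1)] by auto
    moreover have "nu (qcnj (r j) \<odot> a) < g j"
      using backward_le[OF j(1), of a] \<open>nu a < 1\<close> gain_gt_1[OF j(1)]
      by (smt (verit) mult_less_cancel_left2)
    ultimately show False by simp
  qed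
qed

text \<open>
  Such an index is either the one that does not expand \<open>x\<close>, or its gain is \<open>1 / nu x\<close>.
\<close>
lemma few_preimages_of_unit_size:
  assumes "x \<noteq> 0"
  shows "card {i. i < k \<and> nu (qcnj (r i) \<odot> x) = 1} \<le> 2"
proof -
  define J1 where "J1 = {i. i < k \<and> nu (qcnj (r i) \<odot> x) \<noteq> g i * nu x}"
  define J2 where "J2 = {i. i < k \<and> g i = 1 / nu x}"
  have fin: "finite J1" "finite J2" unfolding J1_def J2_def by simp_all
  have "i = j" if "i \<in> J1" "j \<in> J1" for i j
    using that expand_backward[of i j x] unfolding J1_def by blast
  then have "card J1 \<le> Suc 0" using card_le_Suc0_iff_eq[OF fin(1)] by blast
  moreover have "i = j" if "i \<in> J2" "j \<in> J2" for i j
    using that gain_inj[of i j] unfolding J2_def by simp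
  then have "card J2 \<le> Suc 0" using card_le_Suc0_iff_eq[OF fin(2)] by blast
  ultimately have "card (J1 \<union> J2) \<le> 2" using card_Un_le[of J1 J2] by linarith
  moreover have "{i. i < k \<and> nu (qcnj (r i) \<odot> x) = 1} \<subseteq> J1 \<union> J2"
    unfolding J1_def J2_def using nu_pos[OF assms] by (auto simp: nonzero_eq_divide_eq)
  then have "card {i. i < k \<and> nu (qcnj (r i) \<odot> x) = 1} \<le> card (J1 \<union> J2)"
    using fin by (intro card_mono) auto
  ultimately show ?thesis by linarith
qed

text \<open>
  The left nodes are the points all of whose images lie in the ball, without the origin, which all
  rotations fix, and without the points of size \<open>1\<close>, except for \<open>- s\<close>. The centre is covered only
  through \<open>- s\<close> and serves as the distinguished root. Every other point keeps at least two of its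
  four rotation edges.
\<close>
lemma unit_ball_divisible:
  fixes B :: "(real^4) set"
  assumes B: "B = ball 0 1 \<or> B = cball 0 1"
    and s: "s = axis 1 e" "0 < e" "e \<le> 1/4"
    and spread: "\<And>x. \<exists>I\<subseteq>{..<k}. card I = 4 \<and> (\<forall>i\<in>I. r i \<bullet> x \<le> - (e * norm x))"
  shows "divisible {..<Suc k} B"
proof -
  have B_le: "y \<in> B" if "x \<in> B" "norm y \<le> norm x" for x y
    using that B by auto
  have B_less: "y \<in> B" if "norm y < 1" for y
    using that B by auto
  have norm_s: "norm s = e" using s by (simp add: norm_eq_sqrt_inner inner_4 axis_def)
  define f where "f l a = (if l < k then r l \<odot> a else a + s)" for l a
  define A where "A = {a \<in> B. a + s \<in> B \<and> a \<noteq> 0 \<and> (nu a = 1 \<longrightarrow> a = - s)}"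
  define E where "E = {..<Suc k} \<times> A"
  define p :: "nat \<times> (real^4) \<Rightarrow> (real^4) + (real^4)" where "p e = Inl (snd e)" for e
  define q :: "nat \<times> (real^4) \<Rightarrow> (real^4) + (real^4)" where "q e = Inr (f (fst e) (snd e))" for e
  have fB: "f l a \<in> B" if "a \<in> A" for l a
    using that B_le[of a "r l \<odot> a"] unfolding f_def A_def by (auto simp: norm_qmul norm_r)
  have f_inv: "a = (if l < k then qcnj (r l) \<odot> x else x - s)" if "f l a = x" for l a x
    using that r_cancel unfolding f_def by auto
  interpret bipartite_forest E p q "Inr ` B"
  proof
    fix e assume "e \<in> E"
    then show "p e \<notin> Inr ` B" "q e \<in> Inr ` B"
      using fB unfolding E_def p_def q_def by auto
  next
    fix W :: "((real^4) + (real^4)) set"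
    assume W: "finite W" "W \<noteq> {}"
    show "\<exists>v\<in>W. \<forall>e\<in>E. \<forall>e'\<in>E. v \<in> {p e, q e} \<longrightarrow> v \<in> {p e', q e'} \<longrightarrow>
      {p e, q e, p e', q e'} \<subseteq> W \<longrightarrow> e = e'"
    proof (rule ccontr)
      assume contr: "\<not> ?thesis"
      have two: "\<exists>e\<in>E. \<exists>e'\<in>E. e \<noteq> e' \<and> v \<in> {p e, q e} \<and> v \<in> {p e', q e'} \<and> {p e, q e, p e', q e'} \<subseteq> W"
        if "v \<in> W" for v
        using contr that by blast
      define FA where "FA = {a. Inl a \<in> W}"
      define FX where "FX = {x. Inr x \<in> W}"
      have A_two: "\<exists>l<Suc k. \<exists>l'<Suc k. l \<noteq> l' \<and> a \<in> A \<and> f l a \<in> FX \<and> f l' a \<in> FX"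
        if a: "a \<in> FA" for a
      proof -
        have "Inl a \<in> W" using a unfolding FA_def by simp
        then obtain e e' where e: "e \<in> E" "e' \<in> E" "e \<noteq> e'" "Inl a \<in> {p e, q e}" "Inl a \<in> {p e', q e'}"
          "{p e, q e, p e', q e'} \<subseteq> W"
          using two by meson
        then have a_eq: "snd e = a" "snd e' = a" unfolding p_def q_def by auto
        then have "fst e \<noteq> fst e'" using e(3) by (auto simp: prod_eq_iff)
        moreover have "f (fst e) a \<in> FX" "f (fst e') a \<in> FX"
          using e(6) a_eq unfolding FX_def q_def by auto
        moreover have "fst e < Suc k" "fst e' < Suc k" "a \<in> A"
          using e(1,2) a_eq unfolding E_def by auto
        ultimately show ?thesis by blast
      qed
      have X_two: "\<exists>l<Suc k. \<exists>l'<Suc k. l \<noteq> l' \<and> (if l < k then qcnj (r l) \<odot> x else x - s) \<in> FA \<and>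
          (if l' < k then qcnj (r l') \<odot> x else x - s) \<in> FA" if x: "x \<in> FX" for x
      proof -
        have "Inr x \<in> W" using x unfolding FX_def by simp
        then obtain e e' where e: "e \<in> E" "e' \<in> E" "e \<noteq> e'" "Inr x \<in> {p e, q e}" "Inr x \<in> {p e', q e'}"
          "{p e, q e, p e', q e'} \<subseteq> W"
          using two by meson
        then have x_eq: "f (fst e) (snd e) = x" "f (fst e') (snd e') = x" unfolding p_def q_def by auto
        then have inv: "snd e = (if fst e < k then qcnj (r (fst e)) \<odot> x else x - s)"
            "snd e' = (if fst e' < k then qcnj (r (fst e')) \<odot> x else x - s)"
          using f_inv by blast+
        have "fst e < Suc k" "fst e' < Suc k" using e(1,2) unfolding E_def by auto
        moreover have "fst e \<noteq> fst e'"
        proof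
          assume eq: "fst e = fst e'"
          then have "snd e = snd e'" using inv by simp
          then show False using eq e(3) by (simp add: prod_eq_iff)
        qed
        moreover have "snd e \<in> FA" "snd e' \<in> FA" using e(6) unfolding FA_def p_def by auto
        ultimately show ?thesis using inv by metis
      qed
      show False
      proof (rule no_finite_core[of FA FX])
        have "FA = Inl -` W" "FX = Inr -` W" unfolding FA_def FX_def by auto
        then show "finite FA" "finite FX" using W(1) by (auto intro: finite_vimageI)
        obtain v where "v \<in> W" using W by blast
        then show "FA \<union> FX \<noteq> {}" unfolding FA_def FX_def by (cases v) auto
        show "(\<exists>i<k. \<exists>j<k. i \<noteq> j \<and> r i \<odot> a \<in> FX \<and> r j \<odot> a \<in> FX) \<or>
          (\<exists>i<k. r i \<odot> a \<in> FX \<and> a + s \<in> FX)" if a: "a \<in> FA" for a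
        proof -
          obtain l l' where l: "l < Suc k" "l' < Suc k" "l \<noteq> l'" "f l a \<in> FX" "f l' a \<in> FX"
            using A_two[OF a] by meson
          then consider "l < k" "l' < k" | "l < k" "l' = k" | "l = k" "l' < k" by linarith
          then show ?thesis using l unfolding f_def by cases auto
        qed
        show "(\<exists>i<k. \<exists>j<k. i \<noteq> j \<and> qcnj (r i) \<odot> x \<in> FA \<and> qcnj (r j) \<odot> x \<in> FA) \<or>
          (\<exists>i<k. qcnj (r i) \<odot> x \<in> FA \<and> x - s \<in> FA)" if x: "x \<in> FX" for x
        proof -
          obtain l l' where l: "l < Suc k" "l' < Suc k" "l \<noteq> l'"
            "(if l < k then qcnj (r l) \<odot> x else x - s) \<in> FA"
            "(if l' < k then qcnj (r l') \<odot> x else x - s) \<in> FA"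
            using X_two[OF x] by meson
          then consider "l < k" "l' < k" | "l < k" "l' = k" | "l = k" "l' < k" by linarith
          then show ?thesis using l by cases auto
        qed
        show "a \<noteq> 0 \<and> (nu a = 1 \<longrightarrow> a = - s)" if "a \<in> FA" for a
          using A_two[OF that] unfolding A_def by auto
      qed
    qed
  qed
  have "\<exists>S\<subseteq>p ` E. \<forall>x\<in>Inr ` B. \<exists>!e. e \<in> E \<and> q e = x \<and> p e \<in> S"
  proof (rule exists_exact_cover)
    have "0 \<in> B" using B by auto
    then show "Inr 0 \<in> Inr ` B" by simp
    have "- s \<in> A" unfolding A_def using B_less norm_s s \<open>0 \<in> B\<close> by auto
    then have "(k, - s) \<in> E" unfolding E_def by simp
    moreover have "q (k, - s) = Inr 0" unfolding q_def f_def by simp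
    ultimately show "\<exists>e\<in>E. q e = Inr 0" by blast
  next
    fix x' :: "(real^4) + (real^4)" assume "x' \<in> Inr ` B" "x' \<noteq> Inr 0"
    then obtain x where x: "x' = Inr x" "x \<in> B" "x \<noteq> 0" by auto
    obtain I where I: "I \<subseteq> {..<k}" "card I = 4" "\<And>i. i \<in> I \<Longrightarrow> r i \<bullet> x \<le> - (e * norm x)"
      using spread[of x] by blast
    define J where "J = {i. i < k \<and> nu (qcnj (r i) \<odot> x) = 1}"
    have "card J \<le> 2" unfolding J_def using few_preimages_of_unit_size x by blast
    moreover have "card I - card J \<le> card (I - J)" by (rule diff_card_le_card_Diff) (simp add: J_def)
    ultimately have "\<not> card (I - J) \<le> Suc 0" using I by linarith
    moreover have "finite (I - J)" using I finite_subset by blast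
    ultimately obtain i j where ij: "i \<in> I - J" "j \<in> I - J" "i \<noteq> j"
      using card_le_Suc0_iff_eq by blast
    \<comment> \<open>Pulling \<open>x\<close> back by \<open>r i\<close> gives a point of the same norm with real part at most \<open>- e * norm x\<close>; 
      adding \<open>e\<close> does not lengthen it if \<open>norm x \<ge> 1/2\<close>, and shorter points stay in the ball anyway.\<close>
    have edge: "(i, qcnj (r i) \<odot> x) \<in> E \<and> q (i, qcnj (r i) \<odot> x) = x'" if i: "i \<in> I - J" for i
    proof
      let ?a = "qcnj (r i) \<odot> x"
      have "i < k" using i I by auto
      have norm_a: "norm ?a = norm x" using norm_r[OF \<open>i < k\<close>] by (simp add: norm_qmul norm_qcnj)
      have a1: "?a $ 1 \<le> - (e * norm x)" using I(3) i by (simp add: qmul_real_part)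
      have "?a + s \<in> B"
      proof (cases "norm x < 1/2")
        case True
        have "norm (?a + s) \<le> norm ?a + norm s" by (rule norm_triangle_ineq)
        then show ?thesis using True norm_a norm_s s by (intro B_less) linarith
      next
        case False
        have "norm (?a + s) ^ 2 = norm ?a ^ 2 + 2 * (e * ?a $ 1) + e ^ 2"
        proof -
          have "?a \<bullet> s = e * ?a $ 1" using s(1) by (simp add: inner_axis)
          moreover have "norm (?a + s) ^ 2 = norm ?a ^ 2 + 2 * (?a \<bullet> s) + norm s ^ 2"
            unfolding power2_norm_eq_inner by (simp add: inner_add inner_commute)
          ultimately show ?thesis using norm_s by simp
        qed
        also have "e * ?a $ 1 \<le> e * - (e * norm x)"
          using a1 s(2) by (intro mult_left_mono) auto
        also have "norm ?a ^ 2 + 2 * (e * - (e * norm x)) + e ^ 2 \<le> norm ?a ^ 2"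
        proof -
          have "e ^ 2 * 1 \<le> e ^ 2 * (2 * norm x)" using False by (intro mult_left_mono) auto
          then show ?thesis by (simp add: power2_eq_square algebra_simps)
        qed
        finally have "norm (?a + s) \<le> norm x" using norm_a power2_le_imp_le by fastforce
        then show ?thesis using B_le x by blast
      qed
      moreover have "?a \<in> B" using B_le[OF x(2), of ?a] norm_a by simp
      moreover have "?a \<noteq> 0" using norm_a x(3) by (metis norm_eq_zero)
      moreover have "nu ?a \<noteq> 1" using i \<open>i < k\<close> unfolding J_def by auto
      ultimately show "(i, ?a) \<in> E" unfolding E_def A_def using \<open>i < k\<close> by auto
      show "q (i, ?a) = x'" unfolding q_def f_def using \<open>i < k\<close> r_cancel x by simp
    qed
    show "\<exists>e\<in>E. \<exists>e'\<in>E. e \<noteq> e' \<and> q e = x' \<and> q e' = x'"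
      using edge[OF ij(1)] edge[OF ij(2)] ij(3) by blast
  qed
  then obtain S where S: "S \<subseteq> p ` E" "\<And>x. x \<in> B \<Longrightarrow> \<exists>!e. e \<in> E \<and> q e = Inr x \<and> p e \<in> S"
    by (auto simp: image_iff)
  define S' where "S' = {a. Inl a \<in> S}"
  have SA: "S' \<subseteq> A" using S(1) unfolding S'_def p_def E_def by auto
  show ?thesis
  proof (rule divisible_by_exact_cover[of _ f S'])
    show "isometry_of_space (f l)" for l
    proof (cases "l < k")
      case True
      have "surj (f l)" unfolding surj_def f_def using r_cancel(2)[OF True] True by metis
      moreover have "dist (f l x) (f l y) = dist x y" for x y
        using True norm_r[OF True] by (simp add: f_def dist_norm norm_qmul flip: qmul_diff_right)
      ultimately show ?thesis unfolding isometry_of_space_def by blast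
    next
      case False
      have "f l (y - s) = y" for y using False by (simp add: f_def)
      then have "surj (f l)" unfolding surj_def by metis
      then show ?thesis using False unfolding isometry_of_space_def by (simp add: f_def)
    qed
    show "f l a \<in> B" if "a \<in> S'" for l a using that SA fB by blast
    show "B \<noteq> {}" using B_less[of 0] by auto
    show "\<exists>!(l, a). l \<in> {..<Suc k} \<and> a \<in> S' \<and> f l a = x" if "x \<in> B" for x
    proof -
      have "(e \<in> E \<and> q e = Inr x \<and> p e \<in> S) = (case e of (l, a) \<Rightarrow> l \<in> {..<Suc k} \<and> a \<in> S' \<and> f l a = x)" for e
        using SA unfolding E_def q_def p_def S'_def by auto
      then show ?thesis using S(2)[OF that] by simp
    qed
  qed
qed

end

section \<open>An ultrametric norm on the reals\<close>

definition padic_abs :: "int \<Rightarrow> rat \<Rightarrow> real"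
  where "padic_abs q r = (if r = 0 then 0
    else real_of_int q powi (int (multiplicity q (snd (quotient_of r))) - int (multiplicity q (fst (quotient_of r)))))"

lemma padic_abs_0 [simp]: "padic_abs q 0 = 0"
  by (simp add: padic_abs_def)

lemma padic_abs_divide:
  assumes q: "prime q" and "a \<noteq> 0" "b \<noteq> 0"
  shows "padic_abs q (of_int a / of_int b) = real_of_int q powi (int (multiplicity q b) - int (multiplicity q a))"
proof -
  obtain n d where nd: "quotient_of (of_int a / of_int b) = (n, d)" by force
  then have d: "d > 0" "(of_int a / of_int b :: rat) = of_int n / of_int d"
    using quotient_of_denom_pos quotient_of_div by blast+
  then have "(of_int (a * d) :: rat) = of_int (n * b)"
    using assms by (simp add: field_simps)
  then have eq: "a * d = n * b" by (simp only: of_int_eq_iff)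
  then have "n \<noteq> 0" using assms d by auto
  have "multiplicity q a + multiplicity q d = multiplicity q n + multiplicity q b"
    using arg_cong[OF eq, of "multiplicity q"] assms d \<open>n \<noteq> 0\<close>
    by (simp add: prime_elem_multiplicity_mult_distrib[OF prime_imp_prime_elem[OF q]])
  then have "int (multiplicity q d) - int (multiplicity q n) = int (multiplicity q b) - int (multiplicity q a)"
    by linarith
  then show ?thesis using assms nd by (simp add: padic_abs_def)
qed

lemma common_denominator: "\<exists>a b c. c \<noteq> 0 \<and> (r::rat) = of_int a / of_int c \<and> (s::rat) = of_int b / of_int c"
proof -
  obtain a c b d where "quotient_of r = (a, c)" "quotient_of s = (b, d)" by force
  then have "r = of_int a / of_int c" "s = of_int b / of_int d" "c > 0" "d > 0"
    using quotient_of_denom_pos quotient_of_div by blast+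
  then have "c * d \<noteq> 0" "r = of_int (a * d) / of_int (c * d)" "s = of_int (b * c) / of_int (c * d)"
    by auto
  then show ?thesis by blast
qed

lemma padic_abs_nonneg: "prime q \<Longrightarrow> padic_abs q r \<ge> 0"
  by (simp add: padic_abs_def prime_ge_0_int)

lemma padic_abs_eq_0_iff: "prime q \<Longrightarrow> padic_abs q r = 0 \<longleftrightarrow> r = 0"
  by (auto simp: padic_abs_def)

lemma padic_abs_mult:
  assumes q: "prime q"
  shows "padic_abs q (r * s) = padic_abs q r * padic_abs q s"
proof (cases "r = 0 \<or> s = 0")
  case False
  obtain a b c where c: "c \<noteq> 0" "r = of_int a / of_int c" "s = of_int b / of_int c"
    using common_denominator by blast
  have ne: "a \<noteq> 0" "b \<noteq> 0" using c False by auto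
  have "r * s = of_int (a * b) / of_int (c * c)" using c by simp
  then have "padic_abs q (r * s) = real_of_int q powi (int (multiplicity q (c * c)) - int (multiplicity q (a * b)))"
    using padic_abs_divide[OF q, of "a * b" "c * c"] ne c(1) by simp
  also have "\<dots> = real_of_int q powi ((int (multiplicity q c) - int (multiplicity q a)) + (int (multiplicity q c) - int (multiplicity q b)))"
    using ne c(1) q by (simp add: prime_elem_multiplicity_mult_distrib[OF prime_imp_prime_elem[OF q]] algebra_simps)
  also have "\<dots> = padic_abs q r * padic_abs q s"
    using padic_abs_divide[OF q] ne c q by (subst power_int_add) auto
  finally show ?thesis .
qed auto

lemma padic_abs_add:
  assumes q: "prime q"
  shows "padic_abs q (r + s) \<le> max (padic_abs q r) (padic_abs q s)"
proof (cases "r = 0 \<or> s = 0 \<or> r + s = 0")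
  case True
  then show ?thesis using padic_abs_nonneg[OF q] by (auto simp: le_max_iff_disj)
next
  case False
  obtain a b c where c: "c \<noteq> 0" "r = of_int a / of_int c" "s = of_int b / of_int c"
    using common_denominator by blast
  have rs: "r + s = of_int (a + b) / of_int c" using c by (simp add: add_divide_distrib)
  have ne: "a \<noteq> 0" "b \<noteq> 0" "a + b \<noteq> 0" using c rs False by auto
  let ?k = "min (multiplicity q a) (multiplicity q b)"
  have "q ^ ?k dvd a + b"
    by (intro dvd_add multiplicity_dvd') auto
  then have "?k \<le> multiplicity q (a + b)"
    using ne q by (intro multiplicity_geI) auto
  moreover have "real_of_int q \<ge> 1" using prime_ge_1_int[OF q] by simp
  ultimately have "padic_abs q (r + s) \<le> real_of_int q powi (int (multiplicity q c) - int ?k)"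
    unfolding rs padic_abs_divide[OF q ne(3) c(1)] by (intro power_int_increasing) auto
  also have "\<dots> \<le> max (padic_abs q r) (padic_abs q s)"
    unfolding c(2,3) padic_abs_divide[OF q ne(1) c(1)] padic_abs_divide[OF q ne(2) c(1)]
    by (auto simp: min_def le_max_iff_disj)
  finally show ?thesis .
qed

lemma padic_abs_of_int:
  assumes q: "prime q"
  shows "padic_abs q (of_int k) \<le> 1" and "\<not> q dvd k \<Longrightarrow> padic_abs q (of_int k) = 1"
    and "padic_abs q (of_int q) = 1 / real_of_int q"
proof -
  have q1: "real_of_int q \<ge> 1" using prime_ge_1_int[OF q] by simp
  have eq: "padic_abs q (of_int k) = real_of_int q powi (- int (multiplicity q k))" if "k \<noteq> 0" for k
    using padic_abs_divide[OF q that, of 1] q by simp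
  show "padic_abs q (of_int k) \<le> 1"
  proof (cases "k = 0")
    case False
    then show ?thesis using eq[of k] q1 power_int_increasing[OF _ q1, of "- int (multiplicity q k)" 0] by simp
  qed simp
  show "padic_abs q (of_int k) = 1" if "\<not> q dvd k"
    using that eq[of k] by (cases "k = 0") (auto simp: not_dvd_imp_multiplicity_0)
  show "padic_abs q (of_int q) = 1 / real_of_int q"
    using eq[of q] q multiplicity_prime[OF prime_imp_prime_elem[OF q]]
    by (auto simp: power_int_minus field_simps)
qed

text \<open>
  Expand a real number in a basis over the rationals that contains \<open>1\<close>, and take the largest
  \<open>q\<close>-adic absolute value of the coefficients.
\<close>
lemma padic_norm_exists:
  assumes q: "prime q"
  shows "\<exists>N :: real \<Rightarrow> real. (\<forall>x. N x \<ge> 0) \<and> (\<forall>x. N x = 0 \<longrightarrow> x = 0) \<and> N 1 = 1 \<and>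
    (\<forall>x y. N (x + y) \<le> max (N x) (N y)) \<and> (\<forall>c x. N (of_rat c * x) = padic_abs q c * N x)"
proof -
  interpret V: vector_space "\<lambda>c (x::real). of_rat c * x"
    by unfold_locales (auto simp: algebra_simps of_rat_add of_rat_mult)
  have "V.independent {1}" using V.independent_insert[of 1 "{}"] by simp
  define B where "B = V.extend_basis {1}"
  have B: "V.independent B" "1 \<in> B" "V.span B = UNIV"
    using V.independent_extend_basis[of "{1}"] V.extend_basis_superset[of "{1}"] V.span_extend_basis[of "{1}"]
      \<open>V.independent {1}\<close> unfolding B_def by blast+
  define rep where "rep = V.representation B"
  have inB: "x \<in> V.span B" for x using B by auto
  have rep_add: "rep (x + y) b = rep x b + rep y b" for x y b
    unfolding rep_def V.representation_add[OF B(1) inB inB] by simp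
  have rep_scale: "rep (of_rat c * x) b = c * rep x b" for c x b
    unfolding rep_def V.representation_scale[OF B(1) inB] by simp
  have fin: "finite {b. rep x b \<noteq> 0}" for x
    unfolding rep_def by (rule V.finite_representation)
  define N where "N x = Max (insert 0 ((\<lambda>b. padic_abs q (rep x b)) ` {b. rep x b \<noteq> 0}))" for x
  have N_le: "N x \<le> t \<longleftrightarrow> 0 \<le> t \<and> (\<forall>b. padic_abs q (rep x b) \<le> t)" for x t
    unfolding N_def using fin[of x] by (subst Max_le_iff) force+
  have N0: "N x \<ge> 0" for x using N_le[of x "N x"] by simp
  have rep_le: "padic_abs q (rep x b) \<le> N x" for x b using N_le[of x "N x"] by simp
  have def: "x = 0" if "N x = 0" for x
  proof -
    have "rep x b = 0" for b
      using rep_le[of x b] that padic_abs_nonneg[OF q, of "rep x b"] padic_abs_eq_0_iff[OF q] by auto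
    then show ?thesis
      using V.sum_nonzero_representation_eq[OF B(1) inB, of x] unfolding rep_def by simp
  qed
  have "N 1 = 1"
  proof -
    have r1: "rep 1 b = (if b = 1 then 1 else 0)" for b
      unfolding rep_def V.representation_basis[OF B(1,2)] by auto
    have "padic_abs q 1 = 1" using padic_abs_of_int(2)[OF q, of 1] q by auto
    then show ?thesis unfolding N_def r1 by auto
  qed
  moreover have "N (x + y) \<le> max (N x) (N y)" for x y
    unfolding N_le rep_add using padic_abs_add[OF q] rep_le N0
    by (meson le_max_iff_disj max.mono order_trans)
  moreover have "N (of_rat c * x) = padic_abs q c * N x" for c x
  proof -
    have le: "N (of_rat c * x) \<le> padic_abs q c * N x" for c x
      unfolding N_le rep_scale padic_abs_mult[OF q]
      using N0 padic_abs_nonneg[OF q] rep_le by (auto intro: mult_left_mono)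
    show ?thesis
    proof (cases "c = 0")
      case True
      then have "rep (of_rat c * x) b = 0" for b using rep_scale[of 0 x b] by simp
      then show ?thesis using True unfolding N_def by simp
    next
      case False
      have "N x = N (of_rat (inverse c) * (of_rat c * x))"
        using False by (simp add: of_rat_inverse flip: mult.assoc)
      also have "\<dots> \<le> padic_abs q (inverse c) * N (of_rat c * x)" by (rule le)
      finally have "padic_abs q c * N x \<le> (padic_abs q c * padic_abs q (inverse c)) * N (of_rat c * x)"
        using padic_abs_nonneg[OF q, of c] by (simp add: mult_left_mono mult.assoc)
      also have "padic_abs q c * padic_abs q (inverse c) = 1"
        using padic_abs_mult[OF q, of c "inverse c"] False padic_abs_of_int(2)[OF q, of 1] q by auto
      finally show ?thesis using le[of c x] by simp
    qed
  qed
  ultimately show ?thesis using N0 def by blast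
qed

section \<open>An ultrametric norm on the quaternions\<close>

definition integral_vec :: "real^4 \<Rightarrow> bool"
  where "integral_vec x \<longleftrightarrow> (\<forall>i. x $ i \<in> \<int>)"

lemma integral_vec_qcnj: "integral_vec x \<Longrightarrow> integral_vec (qcnj x)"
  by (simp add: integral_vec_def forall_4 qcnj_nth)

locale padic_norm =
  fixes q :: int and N :: "real \<Rightarrow> real"
  assumes q: "prime q"
    and N_nonneg: "N x \<ge> 0"
    and N_definite: "N x = 0 \<Longrightarrow> x = 0"
    and N_1: "N 1 = 1"
    and N_add: "N (x + y) \<le> max (N x) (N y)"
    and N_scale: "N (of_rat c * x) = padic_abs q c * N x"
begin

definition nu :: "real^4 \<Rightarrow> real"
  where "nu a = max (max (N (a$1)) (N (a$2))) (max (N (a$3)) (N (a$4)))"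

lemma N_int: "N (of_int k * x) = padic_abs q (of_int k) * N x"
  using N_scale[of "of_int k" x] by simp

lemma N_int_le: "N (of_int k * x) \<le> N x"
  unfolding N_int using padic_abs_of_int(1)[OF q, of k] N_nonneg[of x] padic_abs_nonneg[OF q]
  by (simp add: mult_left_le_one_le)

lemma N_int_unit: "\<not> q dvd k \<Longrightarrow> N (of_int k * x) = N x"
  unfolding N_int using padic_abs_of_int(2)[OF q, of k] by simp

lemma N_uminus: "N (- x) = N x"
  using N_int_unit[of "-1" x] q by auto

lemma nu_nonneg: "nu a \<ge> 0"
  using N_nonneg by (simp add: nu_def le_max_iff_disj)

lemma nu_zero_iff: "nu a = 0 \<longleftrightarrow> a = 0"
proof
  assume "nu a = 0"
  then have "N (a $ i) \<le> 0" for i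
    using exhaust_4[of i] unfolding nu_def by auto
  then have "a $ i = 0" for i
    using N_definite[of "a $ i"] N_nonneg[of "a $ i"] by (simp add: order_antisym)
  then show "a = 0" by (simp add: vec_eq_iff)
next
  assume "a = 0"
  moreover have "N 0 = 0" using N_int[of 0 0] by simp
  ultimately show "nu a = 0" by (simp add: nu_def)
qed

lemma N_component_le: "N (a $ i) \<le> nu a"
  using exhaust_4[of i] unfolding nu_def by (auto simp: le_max_iff_disj)

lemma nu_le_iff: "nu a \<le> t \<longleftrightarrow> (\<forall>i. N (a $ i) \<le> t)"
  by (auto simp: nu_def forall_4)

lemma nu_add: "nu (a + b) \<le> max (nu a) (nu b)"
  unfolding nu_le_iff using N_add N_component_le
  by (metis max.mono order_trans vector_add_component)

lemma nu_uminus: "nu (- a) = nu a"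
  by (simp add: nu_def N_uminus)

lemma nu_scale: "nu (of_rat c *\<^sub>R a) = padic_abs q c * nu a"
  using padic_abs_nonneg[OF q, of c] by (simp add: nu_def N_scale max_mult_distrib_left)

lemma nu_int_unit: "\<not> q dvd k \<Longrightarrow> nu (of_int k *\<^sub>R a) = nu a"
  by (simp add: nu_def N_int_unit)

lemma nu_qmul_integral:
  assumes "integral_vec x"
  shows "nu (x \<odot> a) \<le> nu a"
proof -
  have product: "N (x $ i * a $ j) \<le> nu a" for i j
  proof -
    obtain m where "x $ i = of_int m" using assms unfolding integral_vec_def by (meson Ints_cases)
    then show ?thesis using N_int_le[of m "a $ j"] N_component_le[of a j] by simp
  qed
  have add: "N (u + v) \<le> nu a" if "N u \<le> nu a" "N v \<le> nu a" for u v
    using N_add[of u v] that by simp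
  have diff: "N (u - v) \<le> nu a" if "N u \<le> nu a" "N v \<le> nu a" for u v
    using add[of u "- v"] that by (simp add: N_uminus)
  have "N ((x \<odot> a) $ i) \<le> nu a" for i
    using exhaust_4[of i] by (elim disjE) (simp_all only: qmul_nth add diff product)
  then show ?thesis by (simp add: nu_le_iff)
qed

text \<open>
  The squared lengths of \<open>x\<close> and \<open>y\<close> vanish modulo \<open>q\<close>, so the squared length of \<open>x + y\<close> is twice their
  inner product modulo \<open>q\<close>, a unit. Hence multiplication by \<open>x + y\<close> preserves \<open>nu\<close>, and \<open>x\<close> and \<open>y\<close>
  cannot both decrease it at \<open>a\<close>.
\<close>
lemma nu_eq_max_qmul:
  assumes int: "integral_vec x" "integral_vec y" and "q \<noteq> 2"
    and "x \<bullet> x = of_int k" "y \<bullet> y = of_int l" "x \<bullet> y = of_int j"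
    and "q dvd k" "q dvd l" "\<not> q dvd j"
  shows "nu a = max (nu (x \<odot> a)) (nu (y \<odot> a))"
proof (rule antisym)
  let ?z = "x + y"
  have "?z \<bullet> ?z = of_int (k + l + 2 * j)"
    using assms by (simp add: inner_add_left inner_add_right inner_commute)
  moreover have "\<not> q dvd k + l + 2 * j"
  proof -
    have "prime (2::int)" by simp
    then have "\<not> q dvd 2" using \<open>q \<noteq> 2\<close> q primes_dvd_imp_eq by blast
    then have "\<not> q dvd 2 * j" using assms q prime_dvd_mult_iff by blast
    then show ?thesis using assms by (simp add: dvd_add_right_iff)
  qed
  ultimately have "nu a = nu (qcnj ?z \<odot> (?z \<odot> a))"
    unfolding qmul_cancel using nu_int_unit by metis
  also have "\<dots> \<le> nu (?z \<odot> a)"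
    using int by (intro nu_qmul_integral integral_vec_qcnj) (simp add: integral_vec_def)
  also have "\<dots> \<le> max (nu (x \<odot> a)) (nu (y \<odot> a))"
    unfolding qmul_add_left by (rule nu_add)
  finally show "nu a \<le> max (nu (x \<odot> a)) (nu (y \<odot> a))" .
  show "max (nu (x \<odot> a)) (nu (y \<odot> a)) \<le> nu a"
    using nu_qmul_integral int by simp
qed

end

section \<open>Angles and axes of the rotations\<close>

text \<open>
  Take a multiple \<open>c\<close> of all elements of \<open>Z\<close>, as \<open>c\<close> and \<open>c\<^sup>2 + 1\<close> are coprime.
\<close>
lemma prime_avoiding:
  fixes Z :: "int set" and K :: int
  assumes "finite Z" "0 \<notin> Z"
  shows "\<exists>c q. c \<ge> K \<and> c > 0 \<and> prime q \<and> q dvd c\<^sup>2 + 1 \<and> (\<forall>z\<in>Z. \<not> q dvd z)"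
proof -
  define c where "c = (\<bar>K\<bar> + 1) * \<bar>\<Prod>Z\<bar>"
  have "\<Prod>Z \<noteq> 0" using assms by (simp add: prod_zero_iff)
  then have pos: "\<bar>\<Prod>Z\<bar> \<ge> 1" by linarith
  have ge: "c \<ge> \<bar>K\<bar> + 1" unfolding c_def using pos by (simp add: mult_le_cancel_left1)
  then have "\<not> is_unit (c\<^sup>2 + 1)" by (simp add: add_nonneg_eq_0_iff)
  moreover have "c\<^sup>2 + 1 \<noteq> 0" by (simp add: add_nonneg_eq_0_iff)
  ultimately obtain q where q: "q dvd c\<^sup>2 + 1" "prime q"
    using prime_divisor_exists by blast
  have "\<not> q dvd z" if "z \<in> Z" for z
  proof
    assume "q dvd z"
    then have "q dvd \<Prod>Z" using that assms(1) by (meson dvd_prodI dvd_trans)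
    then have "q dvd c\<^sup>2" unfolding c_def by (simp add: power2_eq_square)
    then have "q dvd 1" using q(1) by (simp add: dvd_add_right_iff)
    then show False using q(2) by (simp add: not_prime_unit)
  qed
  then show ?thesis using ge q by (intro exI[of _ c] exI[of _ q]) auto
qed

text \<open>
  Here \<open>A + B \<i> = (c + \<i>) ^ (2 * Suc n)\<close>, and \<open>t\<close> is the argument of \<open>(c + \<i>)\<^sup>2\<close>. Modulo \<open>q\<close> the integer
  \<open>c\<close> is a square root of \<open>- 1\<close>; the map \<open>\<i> \<mapsto> - c\<close> kills \<open>c + \<i>\<close>, which gives \<open>A \<equiv> c * B\<close>, whereas
  \<open>\<i> \<mapsto> c\<close> sends it to the unit \<open>2 * c\<close>, so \<open>B\<close> is a unit.
\<close>
lemma gaussian_powers: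
  fixes c q :: int
  assumes "c > 0" and q: "prime q" "q \<noteq> 2" "q dvd c\<^sup>2 + 1"
  defines "t \<equiv> 2 * arctan (1 / real_of_int c)"
  shows "\<exists>A B. real_of_int A = real_of_int (c\<^sup>2 + 1) ^ Suc n * cos (real (Suc n) * t) \<and>
    real_of_int B = real_of_int (c\<^sup>2 + 1) ^ Suc n * sin (real (Suc n) * t) \<and> q dvd A - c * B \<and> \<not> q dvd B"
proof -
  let ?N = "real_of_int (c\<^sup>2 + 1)"
  have "prime (2::int)" by simp
  then have q2: "\<not> q dvd 2" using q primes_dvd_imp_eq by blast
  have qc: "\<not> q dvd c"
  proof
    assume "q dvd c"
    then have "q dvd c\<^sup>2" by (simp add: power2_eq_square)
    then have "q dvd 1" using q(3) by (simp add: dvd_add_right_iff)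
    then show False using q(1) by (simp add: not_prime_unit)
  qed
  have prime_dvd: "q dvd x * y \<longleftrightarrow> q dvd x \<or> q dvd y" for x y
    using q(1) prime_dvd_mult_iff by blast
  have c: "real_of_int c > 0" using assms by simp
  have Npos: "?N > 0" by (simp add: add_nonneg_pos)
  have sq: "sqrt (1 + (1 / real_of_int c)\<^sup>2) ^ 2 = ?N / (real_of_int c)\<^sup>2"
    using c by (simp add: field_simps power2_eq_square)
  have ct: "?N * cos t = real_of_int (c\<^sup>2 - 1)"
  proof -
    have "cos t = 2 * (1 / (?N / (real_of_int c)\<^sup>2)) - 1"
      unfolding t_def cos_double_cos cos_arctan sq[symmetric] power_divide[of 1] by simp
    then have "?N * cos t = 2 * (real_of_int c)\<^sup>2 - ?N"
      using Npos c by (simp only: right_diff_distrib) simp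
    then show ?thesis by simp
  qed
  have st: "?N * sin t = real_of_int (2 * c)"
  proof -
    have "sin t = 2 * (1 / real_of_int c) / (?N / (real_of_int c)\<^sup>2)"
      unfolding t_def sin_double cos_arctan sin_arctan sq[symmetric] by (simp add: power2_eq_square)
    also have "\<dots> = 2 * real_of_int c / ?N" using c by (simp add: power2_eq_square)
    finally show ?thesis using Npos by simp
  qed
  show ?thesis
  proof (induction n)
    case 0
    have "c\<^sup>2 - 1 - c * (2 * c) = - (c\<^sup>2 + 1)" by (simp add: power2_eq_square)
    then have "q dvd c\<^sup>2 - 1 - c * (2 * c)" using q(3) by (metis dvd_minus_iff)
    moreover have "\<not> q dvd 2 * c" using prime_dvd q2 qc by blast
    ultimately show ?case using ct st
      by (intro exI[of _ "c\<^sup>2 - 1"] exI[of _ "2 * c"]) simp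
  next
    case (Suc n)
    then obtain A B where AB: "real_of_int A = ?N ^ Suc n * cos (real (Suc n) * t)"
      "real_of_int B = ?N ^ Suc n * sin (real (Suc n) * t)" "q dvd A - c * B" "\<not> q dvd B" by blast
    define A' B' where "A' = A * (c\<^sup>2 - 1) - B * (2 * c)" and "B' = B * (c\<^sup>2 - 1) + A * (2 * c)"
    have angle: "real (Suc (Suc n)) * t = real (Suc n) * t + t" by (simp add: algebra_simps)
    have "real_of_int A' = ?N ^ Suc (Suc n) * cos (real (Suc (Suc n)) * t)"
    proof -
      have "real_of_int A' = ?N ^ Suc n * cos (real (Suc n) * t) * (?N * cos t) - ?N ^ Suc n * sin (real (Suc n) * t) * (?N * sin t)"
        unfolding A'_def ct st AB(1,2)[symmetric] by simp
      also have "\<dots> = ?N ^ Suc (Suc n) * (cos (real (Suc n) * t) * cos t - sin (real (Suc n) * t) * sin t)"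
        by (simp only: power_Suc) (simp only: algebra_simps)
      finally show ?thesis unfolding angle cos_add .
    qed
    moreover have "real_of_int B' = ?N ^ Suc (Suc n) * sin (real (Suc (Suc n)) * t)"
    proof -
      have "real_of_int B' = ?N ^ Suc n * sin (real (Suc n) * t) * (?N * cos t) + ?N ^ Suc n * cos (real (Suc n) * t) * (?N * sin t)"
        unfolding B'_def ct st AB(1,2)[symmetric] by simp
      also have "\<dots> = ?N ^ Suc (Suc n) * (sin (real (Suc n) * t) * cos t + cos (real (Suc n) * t) * sin t)"
        by (simp only: power_Suc) (simp only: algebra_simps)
      finally show ?thesis unfolding angle sin_add .
    qed
    moreover have "q dvd A' - c * B'"
    proof -
      have "A' - c * B' = (c\<^sup>2 - 1) * (A - c * B) - (2 * c) * B - 2 * c\<^sup>2 * A"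
        unfolding A'_def B'_def by (simp add: algebra_simps power2_eq_square)
      also have "\<dots> = (c\<^sup>2 - 1) * (A - c * B) + 2 * (A - c * B) - 2 * A * (c\<^sup>2 + 1)"
        by (simp add: algebra_simps)
      finally show ?thesis using q(3) AB(3) by (metis dvd_add dvd_diff dvd_mult)
    qed
    moreover have "\<not> q dvd B'"
    proof
      assume "q dvd B'"
      have "4 * B = (c\<^sup>2 + 1) * (3 * B) + (2 * c) * (A - c * B) - B'"
        unfolding B'_def by (simp add: algebra_simps power2_eq_square)
      then have "q dvd 4 * B"
        using q(3) AB(3) \<open>q dvd B'\<close> by (metis dvd_add dvd_diff dvd_mult dvd_mult2)
      then have "q dvd 2 * (2 * B)" by simp
      then show False using prime_dvd q2 AB(4) by blast
    qed
    ultimately show ?case by blast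
  qed
qed

lemma abs_sin_diff_le: "\<bar>sin x - sin y\<bar> \<le> \<bar>x - y\<bar>" for x y :: real
proof -
  have "\<bar>sin ((x - y) / 2)\<bar> * \<bar>cos ((x + y) / 2)\<bar> \<le> \<bar>(x - y) / 2\<bar> * 1"
    by (intro mult_mono abs_sin_x_le_abs_x) auto
  then show ?thesis unfolding sin_diff_sin by (simp add: abs_mult)
qed

lemma abs_cos_diff_le: "\<bar>cos x - cos y\<bar> \<le> \<bar>x - y\<bar>" for x y :: real
proof -
  have "\<bar>sin ((y - x) / 2)\<bar> * \<bar>sin ((x + y) / 2)\<bar> \<le> \<bar>(y - x) / 2\<bar> * 1"
    by (intro mult_mono abs_sin_x_le_abs_x) auto
  then show ?thesis unfolding cos_diff_cos by (simp add: abs_mult abs_minus_commute mult.commute)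
qed

text \<open>
  Multiples of a small step \<open>t\<close> approximate every angle up to \<open>t\<close>. To make the multipliers
  distinct, the \<open>i\<close>-th angle is approximated after \<open>i\<close> full turns.
\<close>
lemma distinct_multiples_near_angles:
  fixes \<phi> :: "nat \<Rightarrow> real"
  assumes "\<And>i. 0 \<le> \<phi> i" "\<And>i. \<phi> i \<le> pi" "0 < t" "t \<le> 1"
  shows "\<exists>n :: nat \<Rightarrow> nat. inj n \<and>
    (\<forall>i. \<bar>cos (real (Suc (n i)) * t) - cos (\<phi> i)\<bar> \<le> t \<and> \<bar>sin (real (Suc (n i)) * t) - sin (\<phi> i)\<bar> \<le> t)"
proof -
  define x where "x i = (\<phi> i + 2 * pi * real i) / t" for i
  define n where "n i = nat \<lfloor>x i\<rfloor>" for i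
  have x0: "x i \<ge> 0" for i unfolding x_def using assms by simp
  have n: "real (n i) \<le> x i \<and> x i < real (n i) + 1" for i
    unfolding n_def using x0[of i] by linarith
  have less: "n i < n j" if "i < j" for i j
  proof -
    have "real (Suc i) \<le> real j" using that by linarith
    then have "2 * pi * real (Suc i) \<le> 2 * pi * real j" by (intro mult_left_mono) auto
    then have "\<phi> i + 2 * pi * real i + t \<le> \<phi> j + 2 * pi * real j"
      using assms(1)[of j] assms(2)[of i] assms(4) pi_gt3 by (simp add: algebra_simps)
    then have "(\<phi> i + 2 * pi * real i + t) / t \<le> x j"
      unfolding x_def using \<open>0 < t\<close> by (intro divide_right_mono) auto
    then have "x i + 1 \<le> x j" unfolding x_def using \<open>0 < t\<close> by (simp add: add_divide_distrib)
    then show ?thesis using n[of i] n[of j] by linarith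
  qed
  have "inj n" using less by (metis injI less_irrefl linorder_neqE_nat)
  moreover have "\<bar>cos (real (Suc (n i)) * t) - cos (\<phi> i)\<bar> \<le> t \<and> \<bar>sin (real (Suc (n i)) * t) - sin (\<phi> i)\<bar> \<le> t" for i
  proof -
    have period: "cos (x i * t) = cos (\<phi> i)" "sin (x i * t) = sin (\<phi> i)"
    proof -
      have "x i * t = \<phi> i + 2 * real i * pi" using \<open>0 < t\<close> by (simp add: x_def)
      then show "cos (x i * t) = cos (\<phi> i)" "sin (x i * t) = sin (\<phi> i)"
        by (simp_all only: cos_add sin_add cos_2npi sin_2npi)
    qed
    have "\<bar>real (Suc (n i)) * t - x i * t\<bar> = \<bar>real (Suc (n i)) - x i\<bar> * t"
      using \<open>0 < t\<close> by (simp add: abs_mult flip: left_diff_distrib)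
    also have "\<dots> \<le> 1 * t" using n[of i] \<open>0 < t\<close> by (intro mult_right_mono) auto
    finally show ?thesis
      using abs_cos_diff_le[of "real (Suc (n i)) * t" "x i * t"] abs_sin_diff_le[of "real (Suc (n i)) * t" "x i * t"]
      unfolding period by linarith
  qed
  ultimately show ?thesis by blast
qed

text \<open>
  The vector \<open>P\<close> divided by \<open>w\<close> is a rational unit quaternion without real part, given with a common
  denominator.
\<close>
definition pure_axis :: "real^4 \<Rightarrow> int \<Rightarrow> bool"
  where "pure_axis P w \<longleftrightarrow> integral_vec P \<and> P $ 1 = 0 \<and> w > 0 \<and> norm P = real_of_int w"

text \<open>
  The rational parametrization of the circle through the unit vectors \<open>U / h\<close> and \<open>V / h\<close> gives
  infinitely many rational points near \<open>U / h\<close>.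
\<close>
lemma pure_axis_near:
  assumes U: "integral_vec U" "U $ 1 = 0" "norm U = real_of_int h"
    and V: "integral_vec V" "V $ 1 = 0" "norm V = real_of_int h"
    and "U \<bullet> V = 0" "h > 0" "\<delta> > 0" "finite F"
  shows "\<exists>P w. pure_axis P w \<and> norm (P /\<^sub>R real_of_int w - U /\<^sub>R real_of_int h) \<le> \<delta> \<and> P /\<^sub>R real_of_int w \<notin> F"
proof -
  define P where "P T = real (T\<^sup>2) *\<^sub>R U - U + real (2 * T) *\<^sub>R V" for T :: nat
  define w where "w T = h * (int (T\<^sup>2) + 1)" for T
  define u where "u T = P T /\<^sub>R real_of_int (w T)" for T
  have h: "real_of_int h > 0" using assms by simp
  have UU: "U \<bullet> U = (real_of_int h)\<^sup>2" "V \<bullet> V = (real_of_int h)\<^sup>2"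
    using U V by (simp_all add: dot_square_norm)
  have wpos: "w T > 0" for T unfolding w_def using \<open>h > 0\<close> by (simp add: add_nonneg_pos)
  have axis: "pure_axis (P T) (w T)" for T
  proof -
    have "integral_vec (P T)"
      using U(1) V(1) unfolding integral_vec_def P_def by simp
    moreover have "P T $ 1 = 0" using U V unfolding P_def by simp
    moreover have "norm (P T) = real_of_int (w T)"
    proof (rule power2_eq_imp_eq)
      show "(norm (P T))\<^sup>2 = (real_of_int (w T))\<^sup>2"
      proof -
        let ?a = "real (T\<^sup>2) - 1" and ?b = "real (2 * T)"
        have "P T = ?a *\<^sub>R U + ?b *\<^sub>R V" unfolding P_def by (simp add: scaleR_diff_left)
        then have "(norm (P T))\<^sup>2 = ?a * ?a * (U \<bullet> U) + 2 * ?a * ?b * (U \<bullet> V) + ?b * ?b * (V \<bullet> V)"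
          unfolding power2_norm_eq_inner
          by (simp only: inner_add_left inner_add_right inner_scaleR_left inner_scaleR_right inner_commute[of V U])
            (simp add: algebra_simps)
        also have "\<dots> = (real_of_int h * (real (T\<^sup>2) + 1))\<^sup>2"
          unfolding UU \<open>U \<bullet> V = 0\<close> by (simp add: algebra_simps power2_eq_square)
        finally show ?thesis unfolding w_def by simp
      qed
      show "0 \<le> real_of_int (w T)" using wpos[of T] by simp
    qed simp
    ultimately show ?thesis using wpos unfolding pure_axis_def by simp
  qed
  have pos: "real (T\<^sup>2) + 1 > 0" for T by (simp add: add_nonneg_pos)
  have u_U: "u T \<bullet> U = real_of_int h * (1 - 2 / (real (T\<^sup>2) + 1))" for T
  proof -
    have "P T \<bullet> U = (real (T\<^sup>2) + 1 - 2) * (real_of_int h)\<^sup>2"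
      unfolding P_def inner_add_left inner_diff_left inner_scaleR_left inner_commute[of V U] UU \<open>U \<bullet> V = 0\<close>
      by (simp add: algebra_simps)
    moreover have "u T \<bullet> U = (P T \<bullet> U) / real_of_int (w T)"
      unfolding u_def inner_scaleR_left by (simp only: divide_inverse mult.commute)
    moreover have "real_of_int (w T) = real_of_int h * (real (T\<^sup>2) + 1)"
      unfolding w_def by simp
    ultimately have "u T \<bullet> U = (real (T\<^sup>2) + 1 - 2) * (real_of_int h)\<^sup>2 / (real_of_int h * (real (T\<^sup>2) + 1))"
      by (simp only:)
    also have "\<dots> = real_of_int h * ((real (T\<^sup>2) + 1 - 2) / (real (T\<^sup>2) + 1))"
      using h by (simp only: power2_eq_square) simp
    also have "(real (T\<^sup>2) + 1 - 2) / (real (T\<^sup>2) + 1) = 1 - 2 / (real (T\<^sup>2) + 1)"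
      using pos[of T] by (simp only: diff_divide_distrib) simp
    finally show ?thesis .
  qed
  have inj: "inj u"
  proof (rule injI)
    fix S T assume "u S = u T"
    then have "real_of_int h * (1 - 2 / (real (S\<^sup>2) + 1)) = real_of_int h * (1 - 2 / (real (T\<^sup>2) + 1))"
      by (simp only: flip: u_U)
    then have "1 - 2 / (real (S\<^sup>2) + 1) = 1 - 2 / (real (T\<^sup>2) + 1)"
      using h by (subst (asm) mult_left_cancel) auto
    then have "2 / (real (S\<^sup>2) + 1) = 2 / (real (T\<^sup>2) + 1)" by linarith
    then have "real (S\<^sup>2) + 1 = real (T\<^sup>2) + 1"
      using pos[of S] pos[of T] by (simp only: divide_cancel_left) simp
    then have "S\<^sup>2 = T\<^sup>2" by (simp only: add_right_cancel of_nat_eq_iff)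
    then show "S = T" by (rule power2_eq_imp_eq) simp_all
  qed
  have near: "norm (u T - U /\<^sub>R real_of_int h) \<le> 4 / real T" if "T \<ge> 1" for T
  proof -
    have T: "real T \<ge> 1" using that by simp
    define D where "D = real T *\<^sub>R (V /\<^sub>R real_of_int h) - U /\<^sub>R real_of_int h"
    have "u T - U /\<^sub>R real_of_int h = (2 / (real (T\<^sup>2) + 1)) *\<^sub>R D"
    proof -
      have "P T = (real (T\<^sup>2) + 1) *\<^sub>R U + 2 *\<^sub>R (real T *\<^sub>R V - U)"
        unfolding P_def by (simp add: algebra_simps scaleR_2)
      then show ?thesis
        unfolding u_def w_def D_def using h pos[of T]
        by (simp add: scaleR_add_right scaleR_diff_right divide_simps mult.commute)
    qed
    then have "norm (u T - U /\<^sub>R real_of_int h) = (2 / (real (T\<^sup>2) + 1)) * norm D"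
      using pos[of T] by (simp only: norm_scaleR) simp
    also have "\<dots> \<le> (2 / (real (T\<^sup>2) + 1)) * (real T + 1)"
    proof (rule mult_left_mono)
      have "norm (real T *\<^sub>R (V /\<^sub>R real_of_int h)) = real T" "norm (U /\<^sub>R real_of_int h) = 1"
        using U V h by simp_all
      then show "norm D \<le> real T + 1" unfolding D_def using norm_triangle_ineq4 by metis
    qed (use pos[of T] in simp)
    also have "\<dots> \<le> (2 / (real T * real T)) * (2 * real T)"
      using T by (intro mult_mono frac_le) (auto simp: power2_eq_square)
    also have "\<dots> = 4 / real T" using T by simp
    finally show ?thesis .
  qed
  obtain T0 :: nat where T0: "real T0 \<ge> 4 / \<delta>" using real_arch_simple by blast
  have "infinite (u ` {Suc T0..})"
    using inj by (simp add: finite_image_iff inj_on_subset infinite_Ici)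
  then obtain T where T: "T \<ge> Suc T0" "u T \<notin> F"
    using \<open>finite F\<close> by (meson atLeast_iff finite_subset image_subsetI)
  then have "4 / \<delta> \<le> real T" using T0 by linarith
  then have "4 / real T \<le> \<delta>" using \<open>\<delta> > 0\<close> T(1) by (simp add: field_simps)
  then have "norm (u T - U /\<^sub>R real_of_int h) \<le> \<delta>" using near[of T] T(1) by simp
  then show ?thesis using axis[of T] T(2) unfolding u_def by blast
qed

lemma sequence_avoiding_plus_minus:
  fixes u :: "'a \<Rightarrow> 'b::real_vector"
  assumes "\<And>i F. finite F \<Longrightarrow> \<exists>x. good i x \<and> u x \<notin> F"
  shows "\<exists>X :: nat \<Rightarrow> 'a. (\<forall>i<k. good i (X i)) \<and>
    (\<forall>i<k. \<forall>j<k. i \<noteq> j \<longrightarrow> u (X i) \<noteq> u (X j) \<and> u (X i) \<noteq> - u (X j))"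
proof (induction k)
  case (Suc k)
  then obtain X where X: "\<forall>i<k. good i (X i)"
    "\<forall>i<k. \<forall>j<k. i \<noteq> j \<longrightarrow> u (X i) \<noteq> u (X j) \<and> u (X i) \<noteq> - u (X j)" by blast
  have "finite ((\<lambda>i. u (X i)) ` {..<k} \<union> (\<lambda>i. - u (X i)) ` {..<k})" by simp
  from assms[OF this, of k] obtain x where x: "good k x"
    "\<forall>i<k. u x \<noteq> u (X i) \<and> u x \<noteq> - u (X i)" by auto
  then have "\<forall>i<k. u (X i) \<noteq> u x \<and> u (X i) \<noteq> - u x" by auto
  then show ?case using X x
    by (intro exI[of _ "X(k := x)"]) (auto simp: less_Suc_eq)
qed simp

text \<open>
  Modulo \<open>q\<close> one has \<open>A * A' \<equiv> c\<^sup>2 * B * B' \<equiv> - B * B'\<close>, so that the combination is \<open>B * B' * (x - v)\<close>.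
  It is the inner product of two of the quaternions below.
\<close>
lemma prime_not_dvd_combination:
  fixes q :: int
  assumes q: "prime q" "q dvd c\<^sup>2 + 1"
    and "q dvd A - c * B" "q dvd A' - c * B'" "\<not> q dvd B" "\<not> q dvd B'" "\<not> q dvd x - v"
  shows "\<not> q dvd v * (A * A') + B * B' * x"
proof
  assume "q dvd v * (A * A') + B * B' * x"
  moreover have "B * B' * (x - v) = (v * (A * A') + B * B' * x) - v * A * (A' - c * B')
      - v * c * B' * (A - c * B) - v * B * B' * (c\<^sup>2 + 1)"
    by (simp add: algebra_simps power2_eq_square)
  ultimately have "q dvd B * B' * (x - v)"
    using assms(2-4) by (metis dvd_diff dvd_mult)
  then show False using assms q prime_dvd_mult_iff by metis
qed

lemma padic_abs_power: "prime q \<Longrightarrow> padic_abs q (x ^ n) = padic_abs q x ^ n"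
  using padic_abs_of_int(2)[of q 1] by (induction n) (auto simp: padic_abs_mult)

lemma integral_inner: "integral_vec x \<Longrightarrow> integral_vec y \<Longrightarrow> x \<bullet> y \<in> \<int>"
  by (simp add: integral_vec_def inner_4)

lemma norm_cos_sin_combination:
  fixes e u :: "'a::real_inner"
  assumes "u \<bullet> u = 1" "e \<bullet> u = 0" "e \<bullet> e = 1"
  shows "norm (cos x *\<^sub>R e + sin x *\<^sub>R u) = 1"
proof -
  have "(cos x *\<^sub>R e + sin x *\<^sub>R u) \<bullet> (cos x *\<^sub>R e + sin x *\<^sub>R u) = (cos x)\<^sup>2 + (sin x)\<^sup>2"
    using assms by (simp add: inner_add_left inner_add_right inner_commute[of u e] power2_eq_square
        del: sin_cos_squared_add sin_cos_squared_add2)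
  then show ?thesis by (simp add: norm_eq_1)
qed

context padic_norm
begin

text \<open>
  Up to the scalar \<open>w i * (c\<^sup>2 + 1) ^ Suc (n i)\<close>, whose \<open>q\<close>-adic absolute value is the inverse of the gain,
  \<open>r i\<close> is the integral quaternion \<open>\<Psi> i\<close> with real part \<open>w i * A i\<close> and imaginary part
  \<open>B i *\<^sub>R P i\<close>. The squared length of \<open>\<Psi> i\<close> vanishes modulo \<open>q\<close>, while the inner products of different
  elements of the family formed by all \<open>\<Psi> i\<close> and their conjugates are units, so the expansion
  properties follow from \<open>nu_eq_max_qmul\<close>.
\<close>
lemma powers_of_axes_expand:
  fixes k :: nat and c :: int and P :: "nat \<Rightarrow> real^4" and w :: "nat \<Rightarrow> int" and n :: "nat \<Rightarrow> nat"
  assumes c: "c > 0" "q \<noteq> 2" "q dvd c\<^sup>2 + 1"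
    and axes: "\<And>i. i < k \<Longrightarrow> pure_axis (P i) (w i)" "\<And>i. i < k \<Longrightarrow> \<not> q dvd w i"
    and inner: "\<And>i j x. i < k \<Longrightarrow> j < k \<Longrightarrow> i \<noteq> j \<Longrightarrow> P i \<bullet> P j = real_of_int x \<Longrightarrow>
      \<not> q dvd x - w i * w j \<and> \<not> q dvd x + w i * w j"
    and n: "inj n"
  defines "t \<equiv> 2 * arctan (1 / real_of_int c)"
  defines "r \<equiv> \<lambda>i. cos (real (Suc (n i)) * t) *\<^sub>R axis 1 1 + sin (real (Suc (n i)) * t) *\<^sub>R (P i /\<^sub>R real_of_int (w i))"
  shows "expanding_rotations k r (axis 1 (1/64)) nu (\<lambda>i. padic_abs q (1 / of_int (c\<^sup>2 + 1)) ^ Suc (n i))"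
proof -
  define N1 where "N1 = c\<^sup>2 + 1"
  define \<kappa> where "\<kappa> = padic_abs q (1 / of_int N1)"
  define g where "g i = \<kappa> ^ Suc (n i)" for i
  have "N1 > 0" unfolding N1_def by (simp add: add_nonneg_pos)
  have prime_dvd: "q dvd x * y \<longleftrightarrow> q dvd x \<or> q dvd y" for x y
    using q prime_dvd_mult_iff by blast
  have "prime (2::int)" by simp
  then have q2: "\<not> q dvd 2" using q c(2) primes_dvd_imp_eq by blast
  have padic_inverse: "padic_abs q (1 / x) * padic_abs q x = 1" if "x \<noteq> 0" for x
    using padic_abs_mult[OF q, of "1 / x" x] padic_abs_of_int(2)[OF q, of 1] q that by auto
  have kappa: "\<kappa> > 1"
  proof -
    obtain m where m: "N1 = q * m" using c(3) N1_def by blast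
    have "padic_abs q (of_int N1) \<le> 1 / real_of_int q * 1"
      unfolding m of_int_mult padic_abs_mult[OF q] padic_abs_of_int(3)[OF q]
      using padic_abs_of_int(1)[OF q, of m] prime_ge_2_int[OF q] by (intro mult_left_mono) auto
    also have "\<dots> < 1" using prime_ge_2_int[OF q] by simp
    finally have "padic_abs q (of_int N1) < 1" .
    moreover have "\<kappa> * padic_abs q (of_int N1) = 1"
      unfolding \<kappa>_def using padic_inverse \<open>N1 > 0\<close> by simp
    moreover have "padic_abs q (of_int N1) \<ge> 0" by (rule padic_abs_nonneg[OF q])
    ultimately show ?thesis
      using mult_right_mono[of \<kappa> 1 "padic_abs q (of_int N1)"] by (cases "\<kappa> \<le> 1") auto
  qed
  have "\<exists>A B. real_of_int A = real_of_int N1 ^ Suc (n i) * cos (real (Suc (n i)) * t) \<and>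
    real_of_int B = real_of_int N1 ^ Suc (n i) * sin (real (Suc (n i)) * t) \<and> q dvd A - c * B \<and> \<not> q dvd B" for i
    unfolding N1_def t_def by (rule gaussian_powers[OF c(1) q c(2,3)])
  then obtain A B where AB: "\<And>i. real_of_int (A i) = real_of_int N1 ^ Suc (n i) * cos (real (Suc (n i)) * t)"
    "\<And>i. real_of_int (B i) = real_of_int N1 ^ Suc (n i) * sin (real (Suc (n i)) * t)"
    "\<And>i. q dvd A i - c * B i" "\<And>i. \<not> q dvd B i" by metis
  have q_A: "\<not> q dvd A i" for i
  proof
    assume "q dvd A i"
    then have "q dvd c * B i" using AB(3)[of i] by (simp add: dvd_diff_right_iff)
    then have "q dvd c" using AB(4) prime_dvd by blast
    then have "q dvd c\<^sup>2" by (simp add: power2_eq_square)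
    then have "q dvd 1" using c(3) by (simp add: dvd_add_right_iff)
    then show False using q by (simp add: not_prime_unit)
  qed
  define \<Psi> where "\<Psi> i = axis 1 (real_of_int (w i * A i)) + real_of_int (B i) *\<^sub>R P i" for i
  have w: "real_of_int (w i) > 0" "norm (P i) = real_of_int (w i)" "P i $ 1 = 0" "integral_vec (P i)" if "i < k" for i
    using axes(1)[OF that] unfolding pure_axis_def by auto
  have \<Psi>_nth: "\<Psi> i $ 1 = real_of_int (w i * A i)" "\<Psi> i $ 2 = real_of_int (B i) * P i $ 2"
    "\<Psi> i $ 3 = real_of_int (B i) * P i $ 3" "\<Psi> i $ 4 = real_of_int (B i) * P i $ 4" if "i < k" for i
    using w(3)[OF that] unfolding \<Psi>_def by (simp_all add: axis_def)
  have \<Psi>_int: "integral_vec (\<Psi> i)" "integral_vec (qcnj (\<Psi> i))" if "i < k" for i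
  proof -
    show "integral_vec (\<Psi> i)"
      using w(4)[OF that] unfolding integral_vec_def \<Psi>_def by (auto simp: axis_def)
    then show "integral_vec (qcnj (\<Psi> i))" by (rule integral_vec_qcnj)
  qed
  have scalar: "r i = of_rat (1 / of_int (w i * N1 ^ Suc (n i))) *\<^sub>R \<Psi> i" if "i < k" for i
  proof -
    have rat: "of_rat (1 / of_int D) = 1 / real_of_int D" for D by (simp add: of_rat_divide)
    have "real_of_int N1 ^ Suc (n i) \<noteq> 0" using \<open>N1 > 0\<close> by simp
    then have "of_rat (1 / of_int (w i * N1 ^ Suc (n i))) *\<^sub>R \<Psi> i =
        cos (real (Suc (n i)) * t) *\<^sub>R axis 1 1 + sin (real (Suc (n i)) * t) *\<^sub>R (P i /\<^sub>R real_of_int (w i))"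
      using w(1,3)[OF that] unfolding \<Psi>_def vec4_eq_iff rat
      by (simp add: axis_def AB divide_simps del: power_Suc)
    then show ?thesis unfolding r_def by simp
  qed
  have gain: "padic_abs q (1 / of_int (w i * N1 ^ Suc (n i))) = g i" if "i < k" for i
  proof -
    have "padic_abs q (1 / of_int (w i)) = 1"
      using padic_inverse[of "of_int (w i)"] padic_abs_of_int(2)[OF q axes(2)[OF that]] w(1)[OF that] by simp
    moreover have "(1 / of_int (w i * N1 ^ Suc (n i)) :: rat) = 1 / of_int (w i) * (1 / of_int N1) ^ Suc (n i)"
      by (simp add: divide_inverse power_inverse)
    ultimately show ?thesis
      unfolding g_def \<kappa>_def by (simp only: padic_abs_mult[OF q] padic_abs_power[OF q] mult_1)
  qed
  have nu_r: "nu (r i \<odot> a) = g i * nu (\<Psi> i \<odot> a)" "nu (qcnj (r i) \<odot> a) = g i * nu (qcnj (\<Psi> i) \<odot> a)"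
    if "i < k" for i a
    unfolding scalar[OF that] qcnj_scaleR qmul_scaleR_left nu_scale gain[OF that] by simp_all
  have norm_P_inner: "P i \<bullet> P i = real_of_int (w i * w i)" if "i < k" for i
    using w(2)[OF that] by (simp add: dot_square_norm power2_eq_square)
  have cross: "\<Psi> i \<bullet> \<Psi> j = real_of_int (w i * w j * (A i * A j) + B i * B j * x)"
    "\<Psi> i \<bullet> qcnj (\<Psi> j) = real_of_int (w i * w j * (A i * A j) + B i * B j * (- x))"
    if "i < k" "j < k" "P i \<bullet> P j = real_of_int x" for i j x
  proof -
    have x: "real_of_int x = P i $ 2 * P j $ 2 + P i $ 3 * P j $ 3 + P i $ 4 * P j $ 4"
      using that w(3) by (simp add: inner_4)
    show "\<Psi> i \<bullet> \<Psi> j = real_of_int (w i * w j * (A i * A j) + B i * B j * x)"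
      "\<Psi> i \<bullet> qcnj (\<Psi> j) = real_of_int (w i * w j * (A i * A j) + B i * B j * (- x))"
      using that by (simp_all add: inner_4 qcnj_nth \<Psi>_nth x algebra_simps)
  qed
  have self: "\<exists>l. \<Psi> i \<bullet> \<Psi> i = real_of_int l \<and> q dvd l" if "i < k" for i
  proof -
    have "\<Psi> i \<bullet> \<Psi> i = real_of_int (w i * w i * (A i * A i) + B i * B i * (w i * w i))"
      by (rule cross(1)[OF that that norm_P_inner[OF that]])
    moreover have "q dvd w i * w i * (A i * A i) + B i * B i * (w i * w i)"
    proof -
      have "w i * w i * (A i * A i) + B i * B i * (w i * w i) =
          w i * w i * (A i + c * B i) * (A i - c * B i) + w i * w i * B i * B i * (c\<^sup>2 + 1)"
        by (simp add: algebra_simps power2_eq_square)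
      then show ?thesis using AB(3)[of i] c(3) by (metis dvd_add dvd_mult)
    qed
    ultimately show ?thesis by blast
  qed
  have inner_ex: "\<exists>x. P i \<bullet> P j = real_of_int x" if "i < k" "j < k" for i j
    using integral_inner[OF w(4)[OF that(1)] w(4)[OF that(2)]] by (auto elim: Ints_cases)
  have forward: "nu a = max (nu (\<Psi> i \<odot> a)) (nu (\<Psi> j \<odot> a))"
    and backward: "nu a = max (nu (qcnj (\<Psi> i) \<odot> a)) (nu (qcnj (\<Psi> j) \<odot> a))"
    if ij: "i < k" "j < k" "i \<noteq> j" for i j a
  proof -
    obtain x where x: "P i \<bullet> P j = real_of_int x" using inner_ex ij by blast
    obtain l where l: "\<Psi> i \<bullet> \<Psi> i = real_of_int l" "q dvd l" using self ij by blast
    obtain l' where l': "\<Psi> j \<bullet> \<Psi> j = real_of_int l'" "q dvd l'" using self ij by blast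
    have nd: "\<not> q dvd w i * w j * (A i * A j) + B i * B j * x"
      using inner[OF ij x] by (intro prime_not_dvd_combination[OF q c(3) AB(3) AB(3) AB(4) AB(4)]) simp
    show "nu a = max (nu (\<Psi> i \<odot> a)) (nu (\<Psi> j \<odot> a))"
      using \<Psi>_int(1) ij by (intro nu_eq_max_qmul[OF _ _ c(2) l(1) l'(1) cross(1)[OF ij(1,2) x] l(2) l'(2) nd])
    show "nu a = max (nu (qcnj (\<Psi> i) \<odot> a)) (nu (qcnj (\<Psi> j) \<odot> a))"
      using \<Psi>_int(2) ij l(1) l'(1) cross(1)[OF ij(1,2) x]
      by (intro nu_eq_max_qmul[OF _ _ c(2) _ _ _ l(2) l'(2) nd]) (auto simp: inner_qcnj)
  qed
  have mixed: "nu a = max (nu (\<Psi> i \<odot> a)) (nu (qcnj (\<Psi> j) \<odot> a))" if ij: "i < k" "j < k" for i j a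
  proof -
    obtain x where x: "P i \<bullet> P j = real_of_int x" using inner_ex ij by blast
    obtain l where l: "\<Psi> i \<bullet> \<Psi> i = real_of_int l" "q dvd l" using self ij by blast
    obtain l' where l': "\<Psi> j \<bullet> \<Psi> j = real_of_int l'" "q dvd l'" using self ij by blast
    have "\<not> q dvd x + w i * w j"
    proof (cases "i = j")
      case True
      then have "real_of_int x = real_of_int (w i * w i)" using norm_P_inner[OF ij(1)] x by metis
      then have "x = w i * w i" by (simp only: of_int_eq_iff)
      then have "x + w i * w j = 2 * (w i * w i)" using True by simp
      then show ?thesis using prime_dvd q2 axes(2)[OF ij(1)] by metis
    qed (use inner[OF ij _ x] in blast)
    then have "\<not> q dvd - x - w i * w j"
      by (metis dvd_minus_iff minus_add_distrib uminus_add_conv_diff add.commute)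
    then have nd: "\<not> q dvd w i * w j * (A i * A j) + B i * B j * (- x)"
      by (intro prime_not_dvd_combination[OF q c(3) AB(3) AB(3) AB(4) AB(4)])
    show ?thesis
      using \<Psi>_int ij l'(1)
      by (intro nu_eq_max_qmul[OF _ _ c(2) l(1) _ cross(2)[OF ij x] l(2) l'(2) nd]) (auto simp: inner_qcnj)
  qed
  have nu_1: "nu (axis 1 1) = 1"
  proof -
    have "N 0 = 0" using N_int[of 0 0] by simp
    then show ?thesis using N_1 by (simp add: nu_def axis_def)
  qed
  have q64: "\<not> q dvd 64"
  proof
    assume "q dvd 64"
    then have "q dvd 2 ^ 6" by simp
    then show False using q2 q prime_dvd_power by blast
  qed
  have s64: "real_of_int 64 *\<^sub>R axis 1 (1/64) = (axis 1 1 :: real^4)"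
    by (simp add: vec4_eq_iff axis_def)
  have "expanding_rotations k r (axis 1 (1/64)) nu g"
  proof
    show "norm (r i) = 1" if "i < k" for i
    proof -
      let ?u = "P i /\<^sub>R real_of_int (w i)"
      have "?u \<bullet> ?u = 1"
        using w(1)[OF that] norm_P_inner[OF that] by (simp add: field_simps)
      moreover have "axis 1 1 \<bullet> ?u = 0" using w(3)[OF that] by (simp add: inner_axis')
      moreover have "axis 1 1 \<bullet> (axis 1 1 :: real^4) = 1" by (simp add: inner_axis_axis)
      ultimately show ?thesis unfolding r_def by (rule norm_cos_sin_combination)
    qed
    show "0 < nu a" if "a \<noteq> 0" for a using nu_nonneg[of a] nu_zero_iff[of a] that by linarith
    show "1 < g i" for i unfolding g_def using kappa by (rule one_less_power) simp
    show "i = j" if "g i = g j" for i j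
      using that kappa n unfolding g_def by (simp add: power_inject_exp inj_eq del: power_Suc)
    show "nu (qcnj (r i) \<odot> a) \<le> g i * nu a" if "i < k" for i a
      unfolding nu_r(2)[OF that] g_def using kappa nu_qmul_integral[OF \<Psi>_int(2)[OF that]]
      by (intro mult_left_mono) auto
    show "nu (axis 1 (1/64)) = 1"
      using nu_int_unit[OF q64, of "axis 1 (1/64)"] unfolding s64 nu_1 by simp
    show "nu (qcnj (r i) \<odot> axis 1 (1/64)) = g i" if "i < k" for i
    proof -
      have "nu (qcnj (\<Psi> i) \<odot> axis 1 (1/64)) = nu (real_of_int 64 *\<^sub>R (qcnj (\<Psi> i) \<odot> axis 1 (1/64)))"
        by (rule nu_int_unit[OF q64, symmetric])
      also have "\<dots> = nu (qcnj (\<Psi> i))" by (simp add: qmul_real)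
      also have "\<dots> = 1"
      proof (rule antisym)
        have "qcnj (\<Psi> i) \<odot> axis 1 1 = qcnj (\<Psi> i)" by (simp add: qmul_real)
        then show "nu (qcnj (\<Psi> i)) \<le> 1"
          using nu_qmul_integral[OF \<Psi>_int(2)[OF that], of "axis 1 1"] nu_1 by simp
        have "\<not> q dvd w i * A i" using prime_dvd axes(2)[OF that] q_A by blast
        then have "N (qcnj (\<Psi> i) $ 1) = 1"
          using N_int_unit[of "w i * A i" 1] N_1 \<Psi>_nth(1)[OF that] by (simp add: qcnj_nth)
        then show "1 \<le> nu (qcnj (\<Psi> i))" using N_component_le[of "qcnj (\<Psi> i)" 1] by simp
      qed
      finally show ?thesis unfolding nu_r(2)[OF that] by simp
    qed
    show "nu (r i \<odot> a) = g i * nu a \<or> nu (r j \<odot> a) = g j * nu a" if "i < k" "j < k" "i \<noteq> j" for i j a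
      using forward[OF that, of a] nu_r(1)[OF that(1)] nu_r(1)[OF that(2)] by (metis max_def)
    show "nu (qcnj (r i) \<odot> a) = g i * nu a \<or> nu (qcnj (r j) \<odot> a) = g j * nu a" if "i < k" "j < k" "i \<noteq> j" for i j a
      using backward[OF that, of a] nu_r(2)[OF that(1)] nu_r(2)[OF that(2)] by (metis max_def)
    show "nu (r i \<odot> a) = g i * nu a \<or> nu (qcnj (r j) \<odot> a) = g j * nu a" if "i < k" "j < k" for i j a
      using mixed[OF that, of a] nu_r(1)[OF that(1)] nu_r(2)[OF that(2)] by (metis max_def)
  qed (use nu_add nu_uminus in auto)
  then show ?thesis unfolding g_def \<kappa>_def N1_def .
qed

end

section \<open>Balls in four dimensions\<close>

lemma unit_vectors_eq:
  fixes a b :: "'a::real_inner"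
  assumes "norm a = 1" "norm b = 1"
  shows "a \<bullet> b = 1 \<Longrightarrow> a = b" and "a \<bullet> b = -1 \<Longrightarrow> a = - b"
proof -
  have ab: "a \<bullet> a = 1" "b \<bullet> b = 1" using assms by (simp_all add: norm_eq_1)
  show "a = b" if "a \<bullet> b = 1"
  proof -
    have "(a - b) \<bullet> (a - b) = 0" using ab that by (simp add: inner_diff inner_commute)
    then show ?thesis by simp
  qed
  show "a = - b" if "a \<bullet> b = -1"
  proof -
    have "(a + b) \<bullet> (a + b) = 0" using ab that by (simp add: inner_add inner_commute)
    then show ?thesis by (simp add: eq_neg_iff_add_eq_0)
  qed
qed

text \<open>
  The targets are the unit quaternions \<open>cos \<phi> + sin \<phi> * u\<close> with \<open>\<phi> = arccos (C i)\<close> and the rational axis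
  \<open>u = U i / h i\<close>. The axes are perturbed to become pairwise neither equal nor opposite, which by the
  equality case of the Cauchy-Schwarz inequality makes the integers in \<open>Z\<close> nonzero.
\<close>
lemma expanding_rotations_near_targets:
  fixes C :: "nat \<Rightarrow> real" and U V :: "nat \<Rightarrow> real^4" and h :: "nat \<Rightarrow> int" and \<delta> :: real
  assumes C: "\<And>i. -1 \<le> C i \<and> C i \<le> 1"
    and U: "\<And>i. integral_vec (U i) \<and> U i $ 1 = 0 \<and> norm (U i) = real_of_int (h i)"
    and V: "\<And>i. integral_vec (V i) \<and> V i $ 1 = 0 \<and> norm (V i) = real_of_int (h i)"
    and UV: "\<And>i. U i \<bullet> V i = 0" and h: "\<And>i. h i > 0" and \<delta>: "0 < \<delta>" "\<delta> \<le> 1"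
  shows "\<exists>r nu g. expanding_rotations k r (axis 1 (1/64)) nu g \<and>
    (\<forall>i<k. norm (r i - (C i *\<^sub>R axis 1 1 + sqrt (1 - (C i)\<^sup>2) *\<^sub>R (U i /\<^sub>R real_of_int (h i)))) \<le> \<delta>)"
proof -
  define good where "good i x = (pure_axis (fst x) (snd x) \<and>
    norm (fst x /\<^sub>R real_of_int (snd x) - U i /\<^sub>R real_of_int (h i)) \<le> \<delta> / 3)" for i and x :: "(real^4) \<times> int"
  define dir where "dir x = fst x /\<^sub>R real_of_int (snd x)" for x :: "(real^4) \<times> int"
  have "\<exists>x. good i x \<and> dir x \<notin> F" if "finite F" for i F
  proof -
    have "\<exists>P w. pure_axis P w \<and> norm (P /\<^sub>R real_of_int w - U i /\<^sub>R real_of_int (h i)) \<le> \<delta> / 3 \<and> P /\<^sub>R real_of_int w \<notin> F"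
      using U[of i] V[of i] UV h \<delta> that by (intro pure_axis_near[where V = "V i"]) auto
    then show ?thesis unfolding good_def dir_def by auto
  qed
  from sequence_avoiding_plus_minus[of good dir k, OF this]
  obtain X where X: "\<And>i. i < k \<Longrightarrow> good i (X i)"
    "\<And>i j. i < k \<Longrightarrow> j < k \<Longrightarrow> i \<noteq> j \<Longrightarrow> dir (X i) \<noteq> dir (X j) \<and> dir (X i) \<noteq> - dir (X j)"
    by blast
  define P where "P i = fst (X i)" for i
  define w where "w i = snd (X i)" for i
  define u where "u i = P i /\<^sub>R real_of_int (w i)" for i
  have axis: "pure_axis (P i) (w i)" and near: "norm (u i - U i /\<^sub>R real_of_int (h i)) \<le> \<delta> / 3" if "i < k" for i
    using X(1)[OF that] unfolding good_def P_def w_def u_def by auto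
  have distinct: "u i \<noteq> u j \<and> u i \<noteq> - u j" if "i < k" "j < k" "i \<noteq> j" for i j
    using X(2)[OF that] unfolding dir_def u_def P_def w_def .
  have w0: "w i > 0" and norm_u: "norm (u i) = 1" if "i < k" for i
    using axis[OF that] unfolding pure_axis_def u_def by auto
  have inner_u: "P i \<bullet> P j = real_of_int (w i * w j) * (u i \<bullet> u j)" if "i < k" "j < k" for i j
    using w0[OF that(1)] w0[OF that(2)] unfolding u_def by (simp add: field_simps)
  define D where "D = {(i, j). i < k \<and> j < k \<and> i \<noteq> j}"
  define Z where "Z = {2} \<union> w ` {..<k} \<union> (\<lambda>(i, j). \<lfloor>P i \<bullet> P j\<rfloor> - w i * w j) ` D \<union> (\<lambda>(i, j). \<lfloor>P i \<bullet> P j\<rfloor> + w i * w j) ` D"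
  have "finite Z"
  proof -
    have "D \<subseteq> {..<k} \<times> {..<k}" unfolding D_def by auto
    then have "finite D" using finite_subset by blast
    then show ?thesis unfolding Z_def by simp
  qed
  moreover have "0 \<notin> Z"
  proof -
    have "\<lfloor>P i \<bullet> P j\<rfloor> - w i * w j \<noteq> 0 \<and> \<lfloor>P i \<bullet> P j\<rfloor> + w i * w j \<noteq> 0" if ij: "i < k" "j < k" "i \<noteq> j" for i j
    proof -
      have "P i \<bullet> P j \<in> \<int>" using axis ij unfolding pure_axis_def by (intro integral_inner) auto
      then obtain x where x: "P i \<bullet> P j = real_of_int x" by (rule Ints_cases)
      have ww: "real_of_int (w i * w j) \<noteq> 0" using w0 ij by (metis mult_pos_pos less_irrefl of_int_0_eq_iff)
      have "u i \<bullet> u j \<noteq> 1" "u i \<bullet> u j \<noteq> -1"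
        using unit_vectors_eq[of "u i" "u j"] norm_u ij distinct[OF ij] by auto
      then have "real_of_int (w i * w j) * (u i \<bullet> u j) \<noteq> real_of_int (w i * w j) * 1"
        "real_of_int (w i * w j) * (u i \<bullet> u j) \<noteq> real_of_int (w i * w j) * -1"
        by (simp_all only: mult_left_cancel[OF ww] not_False_eq_True)
      then have "real_of_int x \<noteq> real_of_int (w i * w j)" "real_of_int x \<noteq> real_of_int (- (w i * w j))"
        using inner_u[OF ij(1,2)] unfolding x by auto
      then have "x \<noteq> w i * w j" "x \<noteq> - (w i * w j)" by (simp_all only: of_int_eq_iff) auto
      then show ?thesis unfolding x by simp
    qed
    then show ?thesis using w0 unfolding Z_def D_def by force
  qed
  ultimately obtain c q where cq: "c \<ge> \<lceil>6 / \<delta>\<rceil>" "c > 0" "prime q" "q dvd c\<^sup>2 + 1" "\<And>z. z \<in> Z \<Longrightarrow> \<not> q dvd z"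
    using prime_avoiding[of Z "\<lceil>6 / \<delta>\<rceil>"] by blast
  obtain N where "padic_norm q N"
    using padic_norm_exists[OF cq(3)] cq(3) unfolding padic_norm_def by blast
  then interpret padic_norm q N .
  define t where "t = 2 * arctan (1 / real_of_int c)"
  have t: "0 < t" "t \<le> \<delta> / 3"
  proof -
    show "0 < t" unfolding t_def using cq(2) by simp
    have "real_of_int c \<ge> 6 / \<delta>" using cq(1) by linarith
    then have "2 * (1 / real_of_int c) \<le> \<delta> / 3" using \<delta> cq(2) by (simp add: field_simps)
    then show "t \<le> \<delta> / 3" unfolding t_def using arctan_le_self[of "1 / real_of_int c"] cq(2) by simp
  qed
  obtain n :: "nat \<Rightarrow> nat" where n: "inj n"
    "\<And>i. \<bar>cos (real (Suc (n i)) * t) - cos (arccos (C i))\<bar> \<le> t"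
    "\<And>i. \<bar>sin (real (Suc (n i)) * t) - sin (arccos (C i))\<bar> \<le> t"
    using distinct_multiples_near_angles[of "\<lambda>i. arccos (C i)" t] arccos_lbound arccos_ubound C t \<delta> by auto
  define r where "r i = cos (real (Suc (n i)) * t) *\<^sub>R axis 1 1 + sin (real (Suc (n i)) * t) *\<^sub>R u i" for i
  have "expanding_rotations k r (axis 1 (1/64)) nu (\<lambda>i. padic_abs q (1 / of_int (c\<^sup>2 + 1)) ^ Suc (n i))"
    unfolding r_def t_def u_def
  proof (rule powers_of_axes_expand)
    show "c > 0" "q dvd c\<^sup>2 + 1" "inj n" using cq n by auto
    show "q \<noteq> 2" using cq(5)[of 2] unfolding Z_def by auto
    show "pure_axis (P i) (w i)" if "i < k" for i using axis that .
    show "\<not> q dvd w i" if "i < k" for i using cq(5)[of "w i"] that unfolding Z_def by blast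
    show "\<not> q dvd x - w i * w j \<and> \<not> q dvd x + w i * w j"
      if ij: "i < k" "j < k" "i \<noteq> j" and x: "P i \<bullet> P j = real_of_int x" for i j x
    proof -
      have "\<lfloor>P i \<bullet> P j\<rfloor> = x" using x by simp
      moreover have "(i, j) \<in> D" unfolding D_def using ij by simp
      ultimately have "x - w i * w j \<in> Z" "x + w i * w j \<in> Z" unfolding Z_def by force+
      then show ?thesis using cq(5) by blast
    qed
  qed
  moreover have "norm (r i - (C i *\<^sub>R axis 1 1 + sqrt (1 - (C i)\<^sup>2) *\<^sub>R (U i /\<^sub>R real_of_int (h i)))) \<le> \<delta>" if i: "i < k" for i
  proof -
    let ?c = "cos (real (Suc (n i)) * t)" and ?s = "sin (real (Suc (n i)) * t)" and ?S = "sqrt (1 - (C i)\<^sup>2)"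
    let ?b = "U i /\<^sub>R real_of_int (h i)"
    have cs: "\<bar>?c - C i\<bar> \<le> \<delta> / 3" "\<bar>?s - ?S\<bar> \<le> \<delta> / 3"
      using n(2)[of i] n(3)[of i] t C[of i] by (simp_all add: sin_arccos_abs sin_arccos)
    have S: "0 \<le> ?S" "?S \<le> 1" using C[of i] by (simp_all add: abs_square_le_1 abs_le_iff)
    have "r i - (C i *\<^sub>R axis 1 1 + ?S *\<^sub>R ?b) = (?c - C i) *\<^sub>R axis 1 1 + (?s - ?S) *\<^sub>R u i + ?S *\<^sub>R (u i - ?b)"
      unfolding r_def by (simp add: algebra_simps)
    also have "norm \<dots> \<le> norm ((?c - C i) *\<^sub>R (axis 1 1 :: real^4)) + norm ((?s - ?S) *\<^sub>R u i) + norm (?S *\<^sub>R (u i - ?b))"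
      by (intro order_trans[OF norm_triangle_ineq] add_mono norm_triangle_ineq order_refl)
    also have "\<dots> = \<bar>?c - C i\<bar> + \<bar>?s - ?S\<bar> + ?S * norm (u i - ?b)"
      using S norm_u[OF i] by (simp add: norm_axis_1)
    also have "\<dots> \<le> \<delta> / 3 + \<delta> / 3 + 1 * (\<delta> / 3)"
      using cs S near[OF i] by (intro add_mono mult_mono) auto
    finally show ?thesis by simp
  qed
  ultimately show ?thesis by blast
qed

text \<open>
  The last of the five vectors is a combination of the others with negative coefficients. If all
  inner products were larger than \<open>- norm x / 21\<close>, every coordinate of \<open>x\<close> would be at most
  \<open>10 * norm x / 21\<close> in absolute value, which is less than half of \<open>norm x\<close>.
\<close>
lemma some_target_points_away:
  fixes x :: "real^4"
  shows "\<exists>y\<in>{vector [1,0,0,0], vector [0,1,0,0], vector [0,0,1,0], vector [0,0,0,1], vector [-9/15,-8/15,-8/15,-4/15]}.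
    y \<bullet> x \<le> - (norm x / 21)"
proof (rule ccontr)
  define \<nu> where "\<nu> = norm x / 21"
  assume "\<not> ?thesis"
  then have b: "x$1 > - \<nu>" "x$2 > - \<nu>" "x$3 > - \<nu>" "x$4 > - \<nu>" "9 * x$1 + 8 * x$2 + 8 * x$3 + 4 * x$4 < 15 * \<nu>"
    unfolding \<nu>_def by (auto simp: inner_4 not_le)
  then have "\<bar>x$1\<bar> \<le> 10 * \<nu>" "\<bar>x$2\<bar> \<le> 10 * \<nu>" "\<bar>x$3\<bar> \<le> 10 * \<nu>" "\<bar>x$4\<bar> \<le> 10 * \<nu>"
    by linarith+
  moreover have "z * z \<le> (10 * \<nu>)\<^sup>2" if "\<bar>z\<bar> \<le> 10 * \<nu>" for z
    using power_mono[OF that abs_ge_zero, of 2] unfolding power2_abs by (simp only: power2_eq_square)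
  ultimately have "x$1 * x$1 \<le> (10 * \<nu>)\<^sup>2" "x$2 * x$2 \<le> (10 * \<nu>)\<^sup>2" "x$3 * x$3 \<le> (10 * \<nu>)\<^sup>2" "x$4 * x$4 \<le> (10 * \<nu>)\<^sup>2"
    by blast+
  then have "x \<bullet> x \<le> 4 * (10 * \<nu>)\<^sup>2" unfolding inner_4 by linarith
  moreover have "(10 * \<nu>)\<^sup>2 = 100 / 441 * (norm x)\<^sup>2"
    unfolding \<nu>_def by (simp add: power2_eq_square)
  ultimately have "(norm x)\<^sup>2 \<le> 400 / 441 * (norm x)\<^sup>2"
    unfolding power2_norm_eq_inner[symmetric] by linarith
  then have "norm x = 0" by simp
  then show False using b unfolding \<nu>_def by simp
qed

text \<open>
  Conjugating an isometry by a similarity gives an isometry.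
\<close>
lemma divisible_similarity:
  fixes K :: "'a::real_normed_vector set"
  assumes "divisible I K" "r > 0"
  shows "divisible I ((\<lambda>x. c + r *\<^sub>R x) ` K)"
proof -
  let ?h = "\<lambda>x. c + r *\<^sub>R x" and ?k = "\<lambda>y. (y - c) /\<^sub>R r"
  have inj: "inj ?h" using \<open>r > 0\<close> by (auto simp: inj_def)
  obtain P where P: "partition_on K P" "P \<approx> I" "\<forall>X\<in>P. \<forall>Y\<in>P. congruent_sets X Y"
    using assms(1) unfolding divisible_def by blast
  let ?Q = "(`) ?h ` P"
  have "partition_on (?h ` K) (?Q - {{}})"
    using inj P(1) by (intro partition_on_inj_image) (auto intro: inj_on_subset)
  moreover have "{} \<notin> ?Q" using P(1) unfolding partition_on_def by auto
  ultimately have "partition_on (?h ` K) ?Q" by simp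
  moreover have "?Q \<approx> I"
  proof -
    have "inj_on ((`) ?h) P" using inj by (meson inj_image_eq_iff inj_onI)
    then have "?Q \<approx> P" by (simp add: inj_on_image_eqpoll_self)
    then show ?thesis using P(2) eqpoll_trans by blast
  qed
  moreover have "congruent_sets (?h ` X) (?h ` Y)" if "X \<in> P" "Y \<in> P" for X Y
  proof -
    obtain f where f: "isometry_of_space f" "f ` X = Y"
      using P(3) \<open>X \<in> P\<close> \<open>Y \<in> P\<close> unfolding congruent_sets_def by blast
    have kh: "?k (?h x) = x" for x using \<open>r > 0\<close> by simp
    have hk: "?h (?k y) = y" for y using \<open>r > 0\<close> by simp
    have "isometry_of_space (\<lambda>y. ?h (f (?k y)))"
      unfolding isometry_of_space_def
    proof (intro conjI allI)
      have surj_f: "surj f" and dist_f: "\<And>a b. dist (f a) (f b) = dist a b"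
        using f(1) unfolding isometry_of_space_def by auto
      show "surj (\<lambda>y. ?h (f (?k y)))"
      proof (rule surjI)
        fix z show "?h (f (?k (?h (inv f (?k z))))) = z"
          unfolding kh surj_f_inv_f[OF surj_f] hk ..
      qed
      fix a b
      have "dist (?h (f (?k a))) (?h (f (?k b))) = r * dist (f (?k a)) (f (?k b))"
        using \<open>r > 0\<close> by (simp add: dist_norm flip: scaleR_diff_right)
      also have "\<dots> = r * dist (?k a) (?k b)" unfolding dist_f ..
      also have "\<dots> = dist a b"
        using \<open>r > 0\<close> by (simp add: dist_norm flip: scaleR_diff_right)
      finally show "dist (?h (f (?k a))) (?h (f (?k b))) = dist a b" .
    qed
    moreover have "(\<lambda>y. ?h (f (?k y))) ` ?h ` X = ?h ` Y"
      unfolding image_image kh f(2)[symmetric] ..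
    ultimately show ?thesis unfolding congruent_sets_def by blast
  qed
  ultimately show ?thesis unfolding divisible_def by blast
qed

text \<open>
  The rotation \<open>r i\<close> is placed near the target with index \<open>i mod 5\<close>, so that twenty rotations
  supply four near each target. The error \<open>1/100\<close> is absorbed by the difference between \<open>1/21\<close> and the
  length \<open>1/64\<close> of the translation. That length is the inverse of a power of \<open>2\<close>, hence a
  unit for every odd prime \<open>q\<close>.
\<close>
lemma unit_ball_divisible_into_many:
  fixes B :: "(real^4) set"
  assumes B: "B = ball 0 1 \<or> B = cball 0 1" and k: "k \<ge> 20"
  shows "divisible {..<Suc k} B"
proof -
  define C :: "nat \<Rightarrow> real" where "C i = [1, 0, 0, 0, -3/5] ! (i mod 5)" for i
  define U :: "nat \<Rightarrow> real^4" where "U i = [vector [0,1,0,0], vector [0,1,0,0], vector [0,0,1,0], vector [0,0,0,1], vector [0,-2,-2,-1]] ! (i mod 5)" for i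
  define V :: "nat \<Rightarrow> real^4" where "V i = [vector [0,0,1,0], vector [0,0,1,0], vector [0,0,0,1], vector [0,1,0,0], vector [0,1,-2,2]] ! (i mod 5)" for i
  define h :: "nat \<Rightarrow> int" where "h i = [1, 1, 1, 1, 3] ! (i mod 5)" for i
  define y :: "nat \<Rightarrow> real^4" where "y i = [vector [1,0,0,0], vector [0,1,0,0], vector [0,0,1,0], vector [0,0,0,1], vector [-9/15,-8/15,-8/15,-4/15]] ! (i mod 5)" for i
  have cases5: "i mod 5 = 0 \<or> i mod 5 = 1 \<or> i mod 5 = 2 \<or> i mod 5 = 3 \<or> i mod 5 = 4" for i :: nat
    by presburger
  have norm_eq: "norm (v::real^4) = real_of_int a" if "v \<bullet> v = real_of_int (a * a)" "a > 0" for v a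
    using that by (simp add: norm_eq_sqrt_inner)
  have "\<exists>r nu g. expanding_rotations k r (axis 1 (1/64)) nu g \<and>
    (\<forall>i<k. norm (r i - (C i *\<^sub>R axis 1 1 + sqrt (1 - (C i)\<^sup>2) *\<^sub>R (U i /\<^sub>R real_of_int (h i)))) \<le> 1/100)"
  proof (rule expanding_rotations_near_targets)
    fix i
    show "-1 \<le> C i \<and> C i \<le> 1" using cases5[of i] unfolding C_def by (elim disjE) simp_all
    show "h i > 0" using cases5[of i] unfolding h_def by (elim disjE) simp_all
    have "norm (U i) = real_of_int (h i)"
      using cases5[of i] unfolding U_def h_def by (intro norm_eq; elim disjE) (simp_all add: inner_4)
    then show "integral_vec (U i) \<and> U i $ 1 = 0 \<and> norm (U i) = real_of_int (h i)"
      using cases5[of i] unfolding U_def h_def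
      by (elim disjE) (simp_all add: integral_vec_def forall_4)
    have "norm (V i) = real_of_int (h i)"
      using cases5[of i] unfolding V_def h_def by (intro norm_eq; elim disjE) (simp_all add: inner_4)
    then show "integral_vec (V i) \<and> V i $ 1 = 0 \<and> norm (V i) = real_of_int (h i)"
      using cases5[of i] unfolding V_def h_def
      by (elim disjE) (simp_all add: integral_vec_def forall_4)
    show "U i \<bullet> V i = 0" using cases5[of i] unfolding U_def V_def by (elim disjE) (simp_all add: inner_4)
  qed simp_all
  then obtain r nu g where r: "expanding_rotations k r (axis 1 (1/64)) nu g"
    and near: "\<And>i. i < k \<Longrightarrow> norm (r i - (C i *\<^sub>R axis 1 1 + sqrt (1 - (C i)\<^sup>2) *\<^sub>R (U i /\<^sub>R real_of_int (h i)))) \<le> 1/100"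
    by blast
  have target: "C i *\<^sub>R axis 1 1 + sqrt (1 - (C i)\<^sup>2) *\<^sub>R (U i /\<^sub>R real_of_int (h i)) = y i" for i
  proof -
    have "sqrt (16 / 25) = 4 / 5" by (rule real_sqrt_unique) (simp_all add: power2_eq_square)
    then show ?thesis using cases5[of i] unfolding C_def U_def h_def y_def
      by (elim disjE) (simp_all add: vec4_eq_iff axis_def power2_eq_square)
  qed
  interpret expanding_rotations k r "axis 1 (1/64)" nu g by (rule r)
  show ?thesis
  proof (rule unit_ball_divisible[OF B refl])
    fix x :: "real^4"
    have "\<exists>j<5. y j \<bullet> x \<le> - (norm x / 21)"
      using some_target_points_away[of x] unfolding y_def
      by (auto intro: exI[of _ 0] exI[of _ 1] exI[of _ 2] exI[of _ 3] exI[of _ 4])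
    then obtain j where j: "j < 5" "y j \<bullet> x \<le> - (norm x / 21)" by blast
    let ?I = "(\<lambda>l. j + 5 * l) ` {..<4}"
    have "?I \<subseteq> {..<k}" using j k by auto
    moreover have "card ?I = 4" by (subst card_image) (auto simp: inj_on_def)
    moreover have "r i \<bullet> x \<le> - (1/64 * norm x)" if "i \<in> ?I" for i
    proof -
      have i: "i < k" "y i = y j" using that \<open>?I \<subseteq> {..<k}\<close> unfolding y_def by auto
      have "(r i - y i) \<bullet> x \<le> norm (r i - y i) * norm x" by (rule norm_cauchy_schwarz)
      also have "\<dots> \<le> 1/100 * norm x" using near[OF i(1)] unfolding target by (rule mult_right_mono) simp
      finally have "r i \<bullet> x \<le> y j \<bullet> x + 1/100 * norm x" using i by (simp add: inner_diff_left)
      also have "\<dots> \<le> - (1/64 * norm x)" using j(2) norm_ge_zero[of x] by linarith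
      finally show ?thesis .
    qed
    ultimately show "\<exists>I\<subseteq>{..<k}. card I = 4 \<and> (\<forall>i\<in>I. r i \<bullet> x \<le> - (1/64 * norm x))" by blast
  qed simp_all
qed

theorem theorem1p2:
  fixes c :: "real ^ 4" and r :: real and B :: "(real ^ 4) set" and m :: nat
  assumes "r > 0"
    and "B = ball c r \<or> B = cball c r"
    and "m \<ge> 22"
  shows "divisible {..<m} B"
proof -
  obtain k where k: "m = Suc k" "k \<ge> 20" using assms(3) by (cases m) auto
  have "(\<lambda>x. c + r *\<^sub>R x) ` ball 0 1 = ball c r" "(\<lambda>x. c + r *\<^sub>R x) ` cball 0 1 = cball c r"
    using ball_scale[of r "0::real^4" 1] cball_scale[of r "0::real^4" 1] assms(1)
    by (simp_all flip: image_image[of "(+) c" "(*\<^sub>R) r"] add: image_add_ball image_add_cball)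
  moreover have "divisible {..<m} (ball (0::real^4) 1)" "divisible {..<m} (cball (0::real^4) 1)"
    unfolding k(1) using unit_ball_divisible_into_many[OF _ k(2)] by blast+
  ultimately show ?thesis
    using divisible_similarity[OF _ assms(1), of "{..<m}" _ c] assms(2) by metis
qed

end
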